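(* Consider an RBM with observed variables $X\in\{-1,1\}^n$ as defined in the context, with parameters $d,s,D,\alpha,\gamma$ as defined there. Fix an observed variable $u$ and a subset $S\subseteq[n]\setminus\{u\}$. Suppose that $S$ does not contain the entire MRF neighborhood of $u$. Then there exists a subset $I$ of the MRF neighborhood of $u$ with $|I|\le 2^s$ such that \[\nu_{u,I|S}\ge\frac{1}{(4d)^{2^s}}\left(\frac1d\right)^{2^s(2^s+1)}\frac{4\alpha^2(e^{-2\gamma})^{d+D-1}}{d^{4d}\,2^{d+1}\binom{D}{d-1}\gamma e^{2\gamma}}.\]
   Context: A Restricted Boltzmann Machine (RBM) is a distribution over observed variables $X\in\{-1,1\}^n$ and latent variables $Y\in\{-1,1\}^m$ with $\mathbb{P}(X=x,Y=y)\propto\exp(x^TJy+h^Tx+g^Ty)$, $J\in\mathbb{R}^{n\times m}$, $h\in\mathbb{R}^n$, $g\in\mathbb{R}^m$; $d$ is the maximum over latent $j$ of $|\{i:J_{i,j}\ne0\}|$. The marginal of $X$ is $\mathbb{P}(X=x)\propto\exp(f(x))$, $f(x)=\sum_{j=1}^m\rho(J_j\cdot x+g_j)+h^Tx$, $J_j$ the $j$-th column of $J$, $\rho(t)=\log(e^t+e^{-t})$; write $f(x)=\sum_{T\subseteq[n]}\hat f(T)\chi_T(x)$, $\chi_T(x)=\prod_{i\in T}x_i$. The MRF neighborhood of $u$ is the set of $i\ne u$ with $\hat f(T)\ne 0$ for some $T\ni u,i$. $s$ is the maximum over $u$ of the number of latent $j$ with $J_{i,j}\ne0$ for some $i$ in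 the MRF neighborhood of $u$. $D$ is the maximum size of an MRF neighborhood; $\alpha$ is the minimum of $|\hat f(T)|$ over $T$ with $\hat f(T)\ne0$; $\gamma=\max_{u\in[n]}\sum_{T\ni u}|\hat f(T)|$. For disjoint $\{u\},I,S$: $\nu_{u,I|S}:=\mathbb{E}_{R,G}\big[\mathbb{E}_{X_S}|\mathbb{P}(X_u=R,X_I=G|X_S)-\mathbb{P}(X_u=R|X_S)\mathbb{P}(X_I=G|X_S)|\big]$ with $R$ uniform on $\{-1,1\}$, $G$ uniform on $\{-1,1\}^{|I|}$, independent, and $X_S$ distributed as the marginal of the RBM. *)

theory Defs
  imports "HOL-Analysis.Analysis" "HOL-Library.FuncSet"
begin

text \<open>Observed variables are indexed by {0..<n}, latent ones by {0..<m}.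
  The interaction matrix is J i j (i observed, j latent); h, g are the biases.
  Configurations of a set of indices A are functions A ->E {-1,1}.\<close>

definition rho :: "real \<Rightarrow> real" where
  "rho t = ln (exp t + exp (- t))"

definition cube :: "nat set \<Rightarrow> (nat \<Rightarrow> real) set" where
  "cube A = (A \<rightarrow>\<^sub>E {-1, 1})"

definition chi :: "nat set \<Rightarrow> (nat \<Rightarrow> real) \<Rightarrow> real" where
  "chi T x = (\<Prod>i\<in>T. x i)"

definition rbm_f :: "nat \<Rightarrow> nat \<Rightarrow> (nat \<Rightarrow> nat \<Rightarrow> real) \<Rightarrow> (nat \<Rightarrow> real) \<Rightarrow> (nat \<Rightarrow> real)
    \<Rightarrow> (nat \<Rightarrow> real) \<Rightarrow> real" where
  "rbm_f n m J h g x =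
     (\<Sum>j<m. rho ((\<Sum>i<n. J i j * x i) + g j)) + (\<Sum>i<n. h i * x i)"

definition fhat :: "nat \<Rightarrow> nat \<Rightarrow> (nat \<Rightarrow> nat \<Rightarrow> real) \<Rightarrow> (nat \<Rightarrow> real) \<Rightarrow> (nat \<Rightarrow> real)
    \<Rightarrow> nat set \<Rightarrow> real" where
  "fhat n m J h g T =
     (\<Sum>x\<in>cube {0..<n}. rbm_f n m J h g x * chi T x) / 2 ^ n"

definition rbm_P :: "nat \<Rightarrow> nat \<Rightarrow> (nat \<Rightarrow> nat \<Rightarrow> real) \<Rightarrow> (nat \<Rightarrow> real) \<Rightarrow> (nat \<Rightarrow> real)
    \<Rightarrow> (nat \<Rightarrow> real) \<Rightarrow> real" where
  "rbm_P n m J h g x =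
     exp (rbm_f n m J h g x) / (\<Sum>y\<in>cube {0..<n}. exp (rbm_f n m J h g y))"

definition rbm_prob :: "nat \<Rightarrow> nat \<Rightarrow> (nat \<Rightarrow> nat \<Rightarrow> real) \<Rightarrow> (nat \<Rightarrow> real) \<Rightarrow> (nat \<Rightarrow> real)
    \<Rightarrow> nat set \<Rightarrow> (nat \<Rightarrow> real) \<Rightarrow> real" where
  "rbm_prob n m J h g A \<sigma> =
     (\<Sum>x\<in>{x\<in>cube {0..<n}. \<forall>i\<in>A. x i = \<sigma> i}. rbm_P n m J h g x)"

text \<open>Conditional probability P(X_A = \<sigma> | X_S = \<tau>) (A, S disjoint).\<close>
definition rbm_cond :: "nat \<Rightarrow> nat \<Rightarrow> (nat \<Rightarrow> nat \<Rightarrow> real) \<Rightarrow> (nat \<Rightarrow> real) \<Rightarrow> (nat \<Rightarrow> real)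
    \<Rightarrow> nat set \<Rightarrow> (nat \<Rightarrow> real) \<Rightarrow> nat set \<Rightarrow> (nat \<Rightarrow> real) \<Rightarrow> real" where
  "rbm_cond n m J h g A \<sigma> S \<tau> =
     rbm_prob n m J h g (A \<union> S) (\<lambda>i. if i \<in> A then \<sigma> i else \<tau> i) / rbm_prob n m J h g S \<tau>"

definition mrf_nbhd :: "nat \<Rightarrow> nat \<Rightarrow> (nat \<Rightarrow> nat \<Rightarrow> real) \<Rightarrow> (nat \<Rightarrow> real) \<Rightarrow> (nat \<Rightarrow> real)
    \<Rightarrow> nat \<Rightarrow> nat set" where
  "mrf_nbhd n m J h g u =
     {i\<in>{0..<n}. i \<noteq> u \<and> (\<exists>T\<subseteq>{0..<n}. u \<in> T \<and> i \<in> T \<and> fhat n m J h g T \<noteq> 0)}"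

definition rbm_d :: "nat \<Rightarrow> nat \<Rightarrow> (nat \<Rightarrow> nat \<Rightarrow> real) \<Rightarrow> nat" where
  "rbm_d n m J = Max (insert 0 ((\<lambda>j. card {i\<in>{0..<n}. J i j \<noteq> 0}) ` {0..<m}))"

definition rbm_s :: "nat \<Rightarrow> nat \<Rightarrow> (nat \<Rightarrow> nat \<Rightarrow> real) \<Rightarrow> (nat \<Rightarrow> real) \<Rightarrow> (nat \<Rightarrow> real) \<Rightarrow> nat" where
  "rbm_s n m J h g = Max (insert 0 ((\<lambda>u. card {j\<in>{0..<m}.
      \<exists>i\<in>mrf_nbhd n m J h g u. J i j \<noteq> 0}) ` {0..<n}))"

definition rbm_D :: "nat \<Rightarrow> nat \<Rightarrow> (nat \<Rightarrow> nat \<Rightarrow> real) \<Rightarrow> (nat \<Rightarrow> real) \<Rightarrow> (nat \<Rightarrow> real) \<Rightarrow> nat" where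
  "rbm_D n m J h g = Max (insert 0 ((\<lambda>u. card (mrf_nbhd n m J h g u)) ` {0..<n}))"

definition rbm_alpha :: "nat \<Rightarrow> nat \<Rightarrow> (nat \<Rightarrow> nat \<Rightarrow> real) \<Rightarrow> (nat \<Rightarrow> real) \<Rightarrow> (nat \<Rightarrow> real) \<Rightarrow> real" where
  "rbm_alpha n m J h g =
     Min {\<bar>fhat n m J h g T\<bar> | T. T \<subseteq> {0..<n} \<and> fhat n m J h g T \<noteq> 0}"

definition rbm_gamma :: "nat \<Rightarrow> nat \<Rightarrow> (nat \<Rightarrow> nat \<Rightarrow> real) \<Rightarrow> (nat \<Rightarrow> real) \<Rightarrow> (nat \<Rightarrow> real) \<Rightarrow> real" where
  "rbm_gamma n m J h g =
     Max ((\<lambda>u. \<Sum>T\<in>{T. T \<subseteq> {0..<n} \<and> u \<in> T}. \<bar>fhat n m J h g T\<bar>) ` {0..<n})"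

text \<open>nu_{u,I|S}: R uniform on {-1,1}, G uniform on {-1,1}^I, X_S from the RBM marginal.\<close>
definition nu :: "nat \<Rightarrow> nat \<Rightarrow> (nat \<Rightarrow> nat \<Rightarrow> real) \<Rightarrow> (nat \<Rightarrow> real) \<Rightarrow> (nat \<Rightarrow> real)
    \<Rightarrow> nat \<Rightarrow> nat set \<Rightarrow> nat set \<Rightarrow> real" where
  "nu n m J h g u I S =
     (\<Sum>R\<in>{-1, 1::real}. \<Sum>G\<in>cube I.
        (1 / 2) * (1 / 2 ^ card I) *
        (\<Sum>\<tau>\<in>cube S. rbm_prob n m J h g S \<tau> *
           \<bar>rbm_cond n m J h g ({u} \<union> I) (G(u := R)) S \<tau>
            - rbm_cond n m J h g {u} (\<lambda>_. R) S \<tau> * rbm_cond n m J h g I G S \<tau>\<bar>))"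

end

theory Submission
  imports Defs
begin

text \<open>
  Let N be the MRF neighborhood of u, and condition on the spins y of the at most s latent variables
  touching N. The spins in N become independent, so for I contained in N - S the quantity
  P(u, I, S) - P(u, S) P(I, S) / P(S) is a sum of q(y) \<Prod>i\<in>I. p(i, y) over k \<le> 2^s points y, where p
  does not depend on the configuration of S.

  On k points, a product of factors with values in [0,1] is a combination of products of fewer than k of
  them, with coefficients of total size at most (2 r + 1)^(k-1) for r factors: for a point y0, telescope
  the product into its value at y0 plus terms with a factor p(i, y) - p(i, y0), which only see the other
  k - 1 points. Hence it suffices to bound the dependence between u and all of N - S.

  Given N, the spin of u is logistic in the discrete derivative of f, whose Fourier coefficients are the
  fhat T with u in T. A nonzero coefficient at some T meeting N - S yields a configuration where flipping
  one spin outside S moves this derivative by at least 4 \<alpha>, so that one of the two configurations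
  witnesses a large dependence.
\<close>

section \<open>Interpolation of products on finitely many points\<close>

text \<open>The outer induction removes one point of \<open>Y\<close>, the inner one adds one factor
  to \<open>A\<close>. The triangle inequality is used for each \<open>t\<close> and then summed, so
  \<open>\<epsilon>\<close> has to control only the sums over \<open>T\<close>.\<close>

lemma prod_functional_bound:
  fixes q :: "'t \<Rightarrow> 'y \<Rightarrow> real" and p :: "'i \<Rightarrow> 'y \<Rightarrow> real"
  assumes "finite Y" "card Y = Suc k" "finite A"
    and "\<And>i y. i \<in> A \<Longrightarrow> y \<in> Y \<Longrightarrow> 0 \<le> p i y \<and> p i y \<le> 1"
    and "\<And>I. I \<subseteq> A \<Longrightarrow> card I \<le> k \<Longrightarrow> (\<Sum>t\<in>T. \<bar>\<Sum>y\<in>Y. q t y * (\<Prod>i\<in>I. p i y)\<bar>) \<le> \<epsilon>"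
  shows "(\<Sum>t\<in>T. \<bar>\<Sum>y\<in>Y. q t y * (\<Prod>i\<in>A. p i y)\<bar>) \<le> (2 * real (card A) + 1) ^ k * \<epsilon>"
  using assms
proof (induction k arbitrary: Y q A \<epsilon>)
  case 0
  then obtain y0 where Y: "Y = {y0}"
    by (auto simp: card_1_singleton_iff)
  \<comment> \<open>On a single point the product is a number of modulus at most 1, so the empty
    product, the case \<open>I = {}\<close> of the hypothesis, dominates it.\<close>
  have le1: "\<bar>\<Prod>i\<in>A. p i y0\<bar> \<le> 1"
    using 0 Y by (auto simp: abs_prod intro!: prod_le_1)
  have "(\<Sum>t\<in>T. \<bar>\<Sum>y\<in>Y. q t y * (\<Prod>i\<in>A. p i y)\<bar>) \<le> (\<Sum>t\<in>T. \<bar>\<Sum>y\<in>Y. q t y * (\<Prod>i\<in>{}. p i y)\<bar>)"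
    using mult_left_mono[OF le1 abs_ge_zero] by (intro sum_mono) (auto simp: Y abs_mult)
  also have "\<dots> \<le> \<epsilon>"
    by (rule 0) auto
  finally show ?case by simp
next
  case (Suc k)
  obtain y0 Y' where Y: "Y = insert y0 Y'" "y0 \<notin> Y'" "card Y' = Suc k" "finite Y'"
    using Suc.prems(1,2) by (metis card_Suc_eq_finite)
  show ?case
    using Suc.prems(3-)
  proof (induction A rule: finite_induct)
    case empty
    from empty(2)[of "{}"] show ?case by simp
  next
    case (insert a A)
    let ?N = "\<lambda>F. \<Sum>t\<in>T. \<bar>\<Sum>y\<in>Y. q t y * F y\<bar>"
    have eps: "0 \<le> \<epsilon>"
      using insert.prems(2)[of "{}"] by (auto intro: order_trans[OF sum_nonneg])
    have pa: "0 \<le> p a y0" "p a y0 \<le> 1"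
      using insert.prems(1) Y(1) by auto
    have IH: "?N (\<lambda>y. \<Prod>i\<in>A. p i y) \<le> (2 * real (card A) + 1) ^ Suc k * \<epsilon>"
      using insert.prems by (intro insert.IH) auto
    \<comment> \<open>The factor \<open>p a y - p a y0\<close> vanishes at \<open>y0\<close>, which
      leaves the points of \<open>Y'\<close>; the outer induction hypothesis then applies with this
      factor absorbed into the weights.\<close>
    have shift: "?N (\<lambda>y. (p a y - p a y0) * F y)
        = (\<Sum>t\<in>T. \<bar>\<Sum>y\<in>Y'. q t y * (p a y - p a y0) * F y\<bar>)" for F
      using Y by (simp add: mult.assoc)
    have "(\<Sum>t\<in>T. \<bar>\<Sum>y\<in>Y'. q t y * (p a y - p a y0) * (\<Prod>i\<in>A. p i y)\<bar>)
        \<le> (2 * real (card A) + 1) ^ k * (2 * \<epsilon>)"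
    proof (rule Suc.IH)
      fix I assume I: "I \<subseteq> A" "card I \<le> k"
      then have fin: "finite I" "a \<notin> I"
        using insert.hyps finite_subset by auto
      have "(\<Sum>t\<in>T. \<bar>\<Sum>y\<in>Y'. q t y * (p a y - p a y0) * (\<Prod>i\<in>I. p i y)\<bar>)
          = ?N (\<lambda>y. (p a y - p a y0) * (\<Prod>i\<in>I. p i y))"
        by (simp add: shift)
      \<comment> \<open>The modified weights turn the product over \<open>I\<close> into a
        combination of the original functionals at \<open>insert a I\<close> and \<open>I\<close>.
        Both sets have at most \<open>Suc k\<close> elements, hence the bound
        \<open>2 * \<epsilon>\<close>.\<close>
      also have "\<dots> = (\<Sum>t\<in>T. \<bar>(\<Sum>y\<in>Y. q t y * (\<Prod>i\<in>insert a I. p i y)) - p a y0 * (\<Sum>y\<in>Y. q t y * (\<Prod>i\<in>I. p i y))\<bar>)"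
        using fin by (simp add: algebra_simps sum_subtractf sum_distrib_left)
      also have "\<dots> \<le> (\<Sum>t\<in>T. \<bar>\<Sum>y\<in>Y. q t y * (\<Prod>i\<in>insert a I. p i y)\<bar> + \<bar>\<Sum>y\<in>Y. q t y * (\<Prod>i\<in>I. p i y)\<bar>)"
      proof (intro sum_mono)
        fix t
        have "\<bar>x - p a y0 * z\<bar> \<le> \<bar>x\<bar> + \<bar>z\<bar>" for x z
          using abs_triangle_ineq4[of x "p a y0 * z"] mult_right_mono[OF pa(2) abs_ge_zero[of z]] pa(1)
          by (simp add: abs_mult)
        then show "\<bar>(\<Sum>y\<in>Y. q t y * (\<Prod>i\<in>insert a I. p i y)) - p a y0 * (\<Sum>y\<in>Y. q t y * (\<Prod>i\<in>I. p i y))\<bar>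
          \<le> \<bar>\<Sum>y\<in>Y. q t y * (\<Prod>i\<in>insert a I. p i y)\<bar> + \<bar>\<Sum>y\<in>Y. q t y * (\<Prod>i\<in>I. p i y)\<bar>" .
      qed
      also have "\<dots> = ?N (\<lambda>y. \<Prod>i\<in>insert a I. p i y) + ?N (\<lambda>y. \<Prod>i\<in>I. p i y)"
        by (rule sum.distrib)
      also have "\<dots> \<le> \<epsilon> + \<epsilon>"
        using I fin by (intro add_mono insert.prems(2)) auto
      finally show "(\<Sum>t\<in>T. \<bar>\<Sum>y\<in>Y'. q t y * (p a y - p a y0) * (\<Prod>i\<in>I. p i y)\<bar>) \<le> 2 * \<epsilon>" by simp
    qed (use Y insert in auto)
    then have step: "?N (\<lambda>y. (p a y - p a y0) * (\<Prod>i\<in>A. p i y)) \<le> (2 * real (card A) + 1) ^ k * (2 * \<epsilon>)"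
      by (simp add: shift)
    have "?N (\<lambda>y. \<Prod>i\<in>insert a A. p i y)
        = (\<Sum>t\<in>T. \<bar>(\<Sum>y\<in>Y. q t y * ((p a y - p a y0) * (\<Prod>i\<in>A. p i y))) + p a y0 * (\<Sum>y\<in>Y. q t y * (\<Prod>i\<in>A. p i y))\<bar>)"
      using insert.hyps by (simp add: algebra_simps sum_subtractf sum_distrib_left)
    also have "\<dots> \<le> (\<Sum>t\<in>T. \<bar>\<Sum>y\<in>Y. q t y * ((p a y - p a y0) * (\<Prod>i\<in>A. p i y))\<bar> + \<bar>\<Sum>y\<in>Y. q t y * (\<Prod>i\<in>A. p i y)\<bar>)"
    proof (intro sum_mono)
      fix t
      have "\<bar>x + p a y0 * z\<bar> \<le> \<bar>x\<bar> + \<bar>z\<bar>" for x z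
        using abs_triangle_ineq[of x "p a y0 * z"] mult_right_mono[OF pa(2) abs_ge_zero[of z]] pa(1)
        by (simp add: abs_mult)
      then show "\<bar>(\<Sum>y\<in>Y. q t y * ((p a y - p a y0) * (\<Prod>i\<in>A. p i y))) + p a y0 * (\<Sum>y\<in>Y. q t y * (\<Prod>i\<in>A. p i y))\<bar>
        \<le> \<bar>\<Sum>y\<in>Y. q t y * ((p a y - p a y0) * (\<Prod>i\<in>A. p i y))\<bar> + \<bar>\<Sum>y\<in>Y. q t y * (\<Prod>i\<in>A. p i y)\<bar>" .
    qed
    also have "\<dots> = ?N (\<lambda>y. (p a y - p a y0) * (\<Prod>i\<in>A. p i y)) + ?N (\<lambda>y. \<Prod>i\<in>A. p i y)"
      by (rule sum.distrib)
    also have "\<dots> \<le> (2 * real (card A) + 1) ^ k * (2 * \<epsilon>) + (2 * real (card A) + 1) ^ Suc k * \<epsilon>"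
      by (intro add_mono step IH)
    also have "\<dots> = (2 * real (card A) + 1) ^ k * (2 * real (card A) + 3) * \<epsilon>"
      by (simp add: algebra_simps)
    \<comment> \<open>\<open>2 * real (card A) + 3\<close> is the base for the set enlarged by
      \<open>a\<close>, so the recursion closes.\<close>
    also have "\<dots> \<le> (2 * real (card A) + 3) ^ k * (2 * real (card A) + 3) * \<epsilon>"
      using eps by (intro mult_right_mono power_mono) auto
    also have "\<dots> = (2 * real (card (insert a A)) + 1) ^ Suc k * \<epsilon>"
      using insert.hyps by (simp add: algebra_simps)
    finally show ?case .
  qed
qed

section \<open>Estimates for the logistic function and for the constants\<close>

text \<open>By the mean value theorem it suffices that the slope of the logistic function is at
  least \<open>exp (- c) / 4\<close> on [-c, c].\<close>

lemma logistic_diff_ge: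
  fixes a b c :: real
  assumes "\<bar>a\<bar> \<le> c" "\<bar>b\<bar> \<le> c"
  shows "exp (- c) / 4 * \<bar>a - b\<bar> \<le> \<bar>exp a / (1 + exp a) - exp b / (1 + exp b)\<bar>"
proof -
  define s :: "real \<Rightarrow> real" where "s t = exp t / (1 + exp t)" for t
  have pos: "0 < 1 + exp t" for t :: real
    by (simp add: add_pos_pos)
  have der: "(s has_real_derivative exp t / (1 + exp t)\<^sup>2) (at t)" for t
    unfolding s_def using pos[of t]
    by (auto intro!: derivative_eq_intros simp: field_simps power2_eq_square)
  have slope: "exp (- c) / 4 \<le> exp t / (1 + exp t)\<^sup>2" if "\<bar>t\<bar> \<le> c" for t
  proof -
    \<comment> \<open>\<open>(t + \<bar>t\<bar>) / 2\<close> is the positive part of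
      \<open>t\<close>; its exponential bounds both 1 and \<open>exp t\<close>.\<close>
    have "(1 + exp t)\<^sup>2 \<le> (2 * exp ((t + \<bar>t\<bar>) / 2))\<^sup>2"
      by (intro power_mono) (auto simp: abs_if)
    also have "\<dots> = 4 * exp (t + \<bar>t\<bar>)"
      by (simp add: power2_eq_square flip: exp_add)
    also have "\<dots> \<le> 4 * exp (t + c)"
      using that by simp
    finally have "exp (- c) * (1 + exp t)\<^sup>2 \<le> exp (-c) * (4 * exp (t + c))"
      by (intro mult_left_mono) auto
    also have "\<dots> = 4 * exp t"
      by (simp flip: exp_add)
    finally show ?thesis
      using pos[of t] by (simp add: field_simps)
  qed
  have "exp (- c) / 4 * (y - x) \<le> s y - s x" if xy: "x < y" "\<bar>x\<bar> \<le> c" "\<bar>y\<bar> \<le> c" for x y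
  proof -
    obtain z where z: "x < z" "z < y" "s y - s x = (y - x) * (exp z / (1 + exp z)\<^sup>2)"
      using MVT2[OF xy(1) der] by blast
    then have "\<bar>z\<bar> \<le> c"
      using xy by auto
    then show ?thesis
      using mult_left_mono[OF slope, of z "y - x"] z xy by (simp add: mult.commute)
  qed
  from this[of a b] this[of b a] assms show ?thesis
    unfolding s_def[symmetric] by (cases a b rule: linorder_cases) (auto simp: abs_minus_commute abs_if)
qed

text \<open>The case split is on k \<le> d^4: then 2^(s d) = k^d is absorbed by d^(4 d), otherwise by d^(k (k + 1)).\<close>
lemma mixture_constants_bound:
  fixes d s D :: nat
  assumes d: "2 \<le> d" and s: "1 \<le> s" and D: "D \<le> s * d"
  defines "k \<equiv> 2 ^ s"
  shows "2 ^ (D + 2) * (2 * (2 * D + 1)) ^ (k - 1) * 4 \<le> (4 * d) ^ k * d ^ (k * (k + 1)) * d ^ (4 * d) * 2 ^ (d + 1)"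
proof -
  have sk: "2 * s \<le> k"
    unfolding k_def using s
  proof (induction s rule: dec_induct)
    case (step i)
    have "2 ^ 1 \<le> (2::nat) ^ i"
      using step by (intro power_increasing) auto
    then show ?case using step by simp
  qed simp
  have k1: "1 \<le> k" by (simp add: k_def)
  have *: "2 ^ (s * d) * k ^ (k - 1) \<le> d ^ (k * (k + 1)) * d ^ (4 * d)"
  proof (cases "k \<le> d ^ 4")
    case True
    have "k ^ (k - 1) = 2 ^ (s * (k - 1))"
      by (simp add: k_def power_mult)
    also have "\<dots> \<le> 2 ^ (k * (k + 1))"
      using sk by (intro power_increasing mult_mono) auto
    also have "\<dots> \<le> d ^ (k * (k + 1))"
      using d by (intro power_mono) auto
    finally have 1: "k ^ (k - 1) \<le> d ^ (k * (k + 1))" .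
    have "2 ^ (s * d) = k ^ d"
      by (simp add: k_def power_mult)
    also have "\<dots> \<le> (d ^ 4) ^ d"
      using True by (intro power_mono) auto
    finally have "2 ^ (s * d) \<le> d ^ (4 * d)"
      by (simp add: power_mult)
    from mult_mono[OF this 1] show ?thesis
      by (simp add: mult.commute)
  next
    case False
    have "d ^ 1 \<le> d ^ 4"
      using d by (intro power_increasing) auto
    then have dk: "d \<le> k" using False by simp
    have "2 ^ (s * d) * k ^ (k - 1) = 2 ^ (s * d + s * (k - 1))"
      by (simp add: k_def power_mult power_add)
    also have "\<dots> \<le> 2 ^ (k * (k + 1))"
    proof (intro power_increasing)
      have "s * d + s * (k - 1) \<le> s * k + s * k"
        using dk by (intro add_mono mult_mono) auto
      also have "\<dots> = (2 * s) * k" by simp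
      also have "\<dots> \<le> k * (k + 1)"
        using sk by (metis le_add1 mult.commute mult_le_mono)
      finally show "s * d + s * (k - 1) \<le> k * (k + 1)" .
    qed auto
    also have "\<dots> \<le> d ^ (k * (k + 1))"
      using d by (intro power_mono) auto
    also have "\<dots> \<le> d ^ (k * (k + 1)) * d ^ (4 * d)"
      using d by simp
    finally show ?thesis .
  qed
  \<comment> \<open>Bounding the base by \<open>4 * d * k\<close> separates a power of
    \<open>4 * d\<close>, which the target contains, from \<open>k ^ (k - 1)\<close>, which the
    inequality \<open>*\<close> absorbs.\<close>
  have "2 * (2 * D + 1) \<le> 4 * (s * d) + 2"
    using D by simp
  also have "\<dots> \<le> 2 * (k * d) + 2 * (k * d)"
  proof -
    have "2 * s * d \<le> k * d"
      using sk by (rule mult_right_mono) simp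
    moreover have "1 * 1 \<le> k * d"
      using k1 d by (intro mult_mono) auto
    ultimately show ?thesis by linarith
  qed
  also have "\<dots> = 4 * d * k" by simp
  finally have base: "2 * (2 * D + 1) \<le> 4 * d * k" .
  have "2 ^ (D + 2) * (2 * (2 * D + 1)) ^ (k - 1) * 4 \<le> 2 ^ (s * d + 2) * (4 * d * k) ^ (k - 1) * 4"
    using D by (intro mult_mono power_increasing power_mono[OF base]) auto
  also have "\<dots> = 16 * (4 * d) ^ (k - 1) * (2 ^ (s * d) * k ^ (k - 1))"
    by (simp add: power_mult_distrib algebra_simps)
  \<comment> \<open>One factor \<open>4 * d\<close> of \<open>(4 * d) ^ k\<close> is still free;
    together with \<open>2 ^ (d + 1)\<close> it pays for 16.\<close>
  also have "\<dots> \<le> (4 * d * 2 ^ (d + 1)) * (4 * d) ^ (k - 1) * (d ^ (k * (k + 1)) * d ^ (4 * d))"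
  proof (rule mult_mono[OF mult_right_mono *])
    have "4 * 2 * 2 ^ 1 \<le> 4 * d * 2 ^ (d + 1)"
      using d by (intro mult_mono power_increasing) auto
    then show "16 \<le> 4 * d * 2 ^ (d + 1)" by simp
  qed auto
  also have "\<dots> = (4 * d) ^ k * d ^ (k * (k + 1)) * d ^ (4 * d) * 2 ^ (d + 1)"
    using k1 by (cases k) (auto simp: algebra_simps)
  finally show ?thesis .
qed

section \<open>Fourier expansion on the cube\<close>

lemma finite_cube [simp]: "finite A \<Longrightarrow> finite (cube A)"
  unfolding cube_def by (intro finite_PiE) auto

lemma card_cube: "finite A \<Longrightarrow> card (cube A) = 2 ^ card A"
  unfolding cube_def by (subst card_PiE) (auto simp: numeral_2_eq_2)

lemma cube_values: "x \<in> cube A \<Longrightarrow> i \<in> A \<Longrightarrow> x i = 1 \<or> x i = -1"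
  by (auto simp: cube_def PiE_def Pi_def)

lemma cube_square: "x \<in> cube A \<Longrightarrow> i \<in> A \<Longrightarrow> x i * x i = 1"
  using cube_values by fastforce

lemma cube_upd: "x \<in> cube A \<Longrightarrow> i \<in> A \<Longrightarrow> r = 1 \<or> r = -1 \<Longrightarrow> x(i := r) \<in> cube A"
  by (auto simp: cube_def PiE_def Pi_def extensional_def)

lemma restrict_cube: "x \<in> cube A \<Longrightarrow> B \<subseteq> A \<Longrightarrow> restrict x B \<in> cube B"
  by (auto simp: cube_def PiE_def Pi_def)

lemma sum_cube_flip:
  assumes "i \<in> A"
  shows "(\<Sum>x\<in>cube A. F (x(i := - x i))) = (\<Sum>x\<in>cube A. F x)"
proof (rule sum.reindex_bij_witness[of _ "\<lambda>x. x(i := - x i)" "\<lambda>x. x(i := - x i)"])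
  fix x assume "x \<in> cube A"
  then have "x(i := - x i) \<in> cube A"
    using assms cube_values[of x A i] by (intro cube_upd) auto
  then show "x(i := - x i) \<in> cube A" "x(i := - x i) \<in> cube A" by auto
qed auto

lemma chi_upd: "finite T \<Longrightarrow> i \<in> T \<Longrightarrow> chi T (x(i := r)) = r * chi (T - {i}) x"
  unfolding chi_def by (simp add: prod.remove[of T i] cong: prod.cong_simp)

lemma chi_upd_notin: "i \<notin> T \<Longrightarrow> chi T (x(i := r)) = chi T x"
  unfolding chi_def by (intro prod.cong) auto

lemma chi_flip: "finite T \<Longrightarrow> i \<in> T \<Longrightarrow> chi T (x(i := - x i)) = - chi T x"
  unfolding chi_def by (simp add: prod.remove[of T i] cong: prod.cong_simp)

lemma abs_chi: "x \<in> cube A \<Longrightarrow> T \<subseteq> A \<Longrightarrow> \<bar>chi T x\<bar> = 1"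
  unfolding chi_def abs_prod using cube_values[of x A] by (intro prod.neutral) fastforce

text \<open>The sum over subsets factors into the product of the \<open>x i * y i + 1\<close>, each
  of which is 2 where the points agree and 0 where they differ.\<close>

lemma sum_chi_mult:
  assumes "finite A" "x \<in> cube A" "y \<in> cube A"
  shows "(\<Sum>T\<in>Pow A. chi T x * chi T y) = (if x = y then 2 ^ card A else 0)"
proof -
  have "(\<Sum>T\<in>Pow A. chi T x * chi T y) = (\<Prod>i\<in>A. x i * y i + 1)"
    by (subst prod_add[OF assms(1)]) (simp add: chi_def prod.distrib)
  also have "\<dots> = (if x = y then 2 ^ card A else 0)"
  proof (cases "x = y")
    case True
    then show ?thesis using cube_square[OF assms(3)] by simp
  next
    case False
    then obtain i where "i \<in> A" "x i \<noteq> y i"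
      using assms(2,3) unfolding cube_def by (metis PiE_ext)
    then have "\<exists>i\<in>A. x i * y i + 1 = 0"
      using cube_values[OF assms(2)] cube_values[OF assms(3)] by (intro bexI[of _ i]) fastforce+
    then show ?thesis using False assms(1) by (simp add: prod_zero)
  qed
  finally show ?thesis .
qed

lemma fourier_expansion:
  assumes "x \<in> cube {0..<n}"
  shows "rbm_f n m J h g x = (\<Sum>T\<in>Pow {0..<n}. fhat n m J h g T * chi T x)"
proof -
  let ?f = "rbm_f n m J h g" and ?C = "cube {0..<n}"
  have "(\<Sum>T\<in>Pow {0..<n}. fhat n m J h g T * chi T x)
      = (\<Sum>T\<in>Pow {0..<n}. \<Sum>y\<in>?C. ?f y * (chi T y * chi T x)) / 2 ^ n"
    by (simp add: fhat_def sum_divide_distrib sum_distrib_right mult.assoc)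
  also have "(\<Sum>T\<in>Pow {0..<n}. \<Sum>y\<in>?C. ?f y * (chi T y * chi T x))
      = (\<Sum>y\<in>?C. ?f y * (\<Sum>T\<in>Pow {0..<n}. chi T y * chi T x))"
    by (subst sum.swap) (simp add: sum_distrib_left)
  also have "\<dots> = (\<Sum>y\<in>?C. if y = x then ?f y * 2 ^ n else 0)"
    using assms by (intro sum.cong) (auto simp: sum_chi_mult)
  also have "\<dots> = ?f x * 2 ^ n"
    using assms by simp
  finally show ?thesis by simp
qed

text \<open>Only characters containing \<open>u\<close> react to the spin \<open>u\<close>, and they
  change sign with it. The difference is the log odds of this spin given all others.\<close>

lemma rbm_f_diff:
  assumes "x \<in> cube {0..<n}" "u < n"
  shows "rbm_f n m J h g (x(u := 1)) - rbm_f n m J h g (x(u := -1))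
    = 2 * (\<Sum>T\<in>{T. T \<subseteq> {0..<n} \<and> u \<in> T}. fhat n m J h g T * chi (T - {u}) x)"
proof -
  have fin: "finite T" if "T \<subseteq> {0..<n}" for T
    using that finite_subset by blast
  have "rbm_f n m J h g (x(u := 1)) - rbm_f n m J h g (x(u := -1))
    = (\<Sum>T\<in>Pow {0..<n}. fhat n m J h g T * (chi T (x(u := 1)) - chi T (x(u := -1))))"
    using assms by (simp add: fourier_expansion cube_upd sum_subtractf right_diff_distrib)
  also have "\<dots> = (\<Sum>T\<in>Pow {0..<n}. if u \<in> T then 2 * (fhat n m J h g T * chi (T - {u}) x) else 0)"
    by (intro sum.cong) (auto simp: chi_upd chi_upd_notin fin)
  also have "\<dots> = (\<Sum>T\<in>{T. T \<subseteq> {0..<n} \<and> u \<in> T}. 2 * (fhat n m J h g T * chi (T - {u}) x))"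
    by (intro sum.mono_neutral_cong_right) auto
  finally show ?thesis by (simp add: sum_distrib_left)
qed

lemma rbm_f_diff_le_gamma:
  assumes "x \<in> cube {0..<n}" "u < n"
  shows "\<bar>rbm_f n m J h g (x(u := 1)) - rbm_f n m J h g (x(u := -1))\<bar> \<le> 2 * rbm_gamma n m J h g"
proof -
  have "\<bar>\<Sum>T\<in>{T. T \<subseteq> {0..<n} \<and> u \<in> T}. fhat n m J h g T * chi (T - {u}) x\<bar>
      \<le> (\<Sum>T\<in>{T. T \<subseteq> {0..<n} \<and> u \<in> T}. \<bar>fhat n m J h g T * chi (T - {u}) x\<bar>)"
    by (rule sum_abs)
  also have "\<dots> = (\<Sum>T\<in>{T. T \<subseteq> {0..<n} \<and> u \<in> T}. \<bar>fhat n m J h g T\<bar>)"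
  proof (intro sum.cong refl)
    fix T assume "T \<in> {T. T \<subseteq> {0..<n} \<and> u \<in> T}"
    then have "\<bar>chi (T - {u}) x\<bar> = 1"
      by (intro abs_chi[OF assms(1)]) auto
    then show "\<bar>fhat n m J h g T * chi (T - {u}) x\<bar> = \<bar>fhat n m J h g T\<bar>"
      by (simp add: abs_mult)
  qed
  also have "\<dots> \<le> rbm_gamma n m J h g"
    unfolding rbm_gamma_def using assms(2) by (intro Max_ge) auto
  finally show ?thesis by (simp add: rbm_f_diff[OF assms])
qed

text \<open>This is the Markov property of \<open>u\<close>: a set \<open>T\<close> that contributes
  to the log odds has \<open>T - {u}\<close> inside the neighborhood.\<close>

lemma rbm_f_diff_cong:
  assumes "x \<in> cube {0..<n}" "x' \<in> cube {0..<n}" "u < n"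
    and "\<And>i. i \<in> mrf_nbhd n m J h g u \<Longrightarrow> x i = x' i"
  shows "rbm_f n m J h g (x(u := 1)) - rbm_f n m J h g (x(u := -1))
    = rbm_f n m J h g (x'(u := 1)) - rbm_f n m J h g (x'(u := -1))"
  unfolding rbm_f_diff[OF assms(1,3)] rbm_f_diff[OF assms(2,3)]
proof (intro arg_cong[of _ _ "\<lambda>z. 2 * z"] sum.cong refl)
  fix T assume T: "T \<in> {T. T \<subseteq> {0..<n} \<and> u \<in> T}"
  show "fhat n m J h g T * chi (T - {u}) x = fhat n m J h g T * chi (T - {u}) x'"
  proof (cases "fhat n m J h g T = 0")
    case False
    then have "T - {u} \<subseteq> mrf_nbhd n m J h g u"
      using T by (auto simp: mrf_nbhd_def)
    then have "chi (T - {u}) x = chi (T - {u}) x'"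
      unfolding chi_def using assms(4) by (intro prod.cong) auto
    then show ?thesis by simp
  qed simp
qed

text \<open>Flipping \<open>u\<close> or \<open>i\<close> reverses the sign of \<open>chi T\<close>,
  flipping both restores it, so each of the four terms contributes
  \<open>2 ^ n * fhat n m J h g T\<close>.\<close>

lemma fhat_second_difference:
  assumes "T \<subseteq> {0..<n}" "u \<in> T" "i \<in> T" "u \<noteq> i"
  shows "4 * 2 ^ n * fhat n m J h g T = (\<Sum>x\<in>cube {0..<n}. chi T x *
    (rbm_f n m J h g x - rbm_f n m J h g (x(u := - x u)) - rbm_f n m J h g (x(i := - x i))
      + rbm_f n m J h g (x(u := - x u, i := - x i))))"
proof -
  let ?f = "rbm_f n m J h g" and ?C = "cube {0..<n}"
  let ?s = "\<Sum>x\<in>?C. chi T x * ?f x"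
  have T: "finite T" "u \<in> {0..<n}" "i \<in> {0..<n}"
    using assms finite_subset by auto
  have flip: "(\<Sum>x\<in>?C. chi T x * F (x(j := - x j))) = - (\<Sum>x\<in>?C. chi T x * F x)"
    if "j \<in> T" for j F
    using sum_cube_flip[of j "{0..<n}" "\<lambda>x. - (chi T x * F x)"] that assms(1)
    by (auto simp: chi_flip[OF T(1) that] sum_negf)
  have "(\<Sum>x\<in>?C. chi T x * ?f (x(u := - x u, i := - x i))) = ?s"
    using flip[OF assms(2), of "\<lambda>x. ?f (x(i := - x i))"] flip[OF assms(3), of ?f] assms(4) by simp
  then show ?thesis
    using flip[OF assms(2), of ?f] flip[OF assms(3), of ?f]
    by (simp add: algebra_simps sum.distrib sum_subtractf fhat_def)
qed

section \<open>Shared latent variables and the parameters d, s, D\<close>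

lemma linear_upd:
  fixes a x :: "nat \<Rightarrow> real"
  assumes "i < n"
  shows "(\<Sum>l<n. a l * (x(i := r)) l) = (\<Sum>l<n. a l * x l) + a i * (r - x i)"
proof -
  have "(\<Sum>l<n. a l * (x(i := r)) l) = (\<Sum>l<n. a l * x l + (if l = i then a i * (r - x i) else 0))"
    by (intro sum.cong) (auto simp: algebra_simps)
  then show ?thesis using assms by (simp add: sum.distrib)
qed

text \<open>The second difference in \<open>u\<close> and \<open>i\<close> kills the linear part and
  every \<open>rho\<close> term whose argument ignores one of the two spins. Without a common latent
  variable nothing is left.\<close>

lemma fhat_nonzero_common_latent:
  assumes "T \<subseteq> {0..<n}" "u \<in> T" "i \<in> T" "u \<noteq> i" "fhat n m J h g T \<noteq> 0"
  shows "\<exists>j<m. J u j \<noteq> 0 \<and> J i j \<noteq> 0"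
proof (rule ccontr)
  assume no: "\<not> ?thesis"
  have un: "u < n" "i < n" using assms by auto
  define t where "t j x = (\<Sum>l<n. J l j * x l) + g j" for j and x :: "nat \<Rightarrow> real"
  have upd: "t j (x(l := r)) = t j x + J l j * (r - x l)" if "l < n" for j x l r
    using linear_upd[OF that, of "\<lambda>l. J l j"] by (simp add: t_def)
  have f: "rbm_f n m J h g x = (\<Sum>j<m. rho (t j x)) + (\<Sum>l<n. h l * x l)" for x
    by (simp add: rbm_f_def t_def)
  have "rbm_f n m J h g x - rbm_f n m J h g (x(u := - x u)) - rbm_f n m J h g (x(i := - x i))
      + rbm_f n m J h g (x(u := - x u, i := - x i)) = 0" for x
  proof -
    have "(\<Sum>j<m. rho (t j x) - rho (t j (x(u := - x u))) - rho (t j (x(i := - x i)))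
        + rho (t j (x(u := - x u, i := - x i)))) = 0"
    proof (intro sum.neutral ballI)
      fix j assume "j \<in> {..<m}"
      then have "J u j = 0 \<or> J i j = 0" using no by auto
      then show "rho (t j x) - rho (t j (x(u := - x u))) - rho (t j (x(i := - x i)))
        + rho (t j (x(u := - x u, i := - x i))) = 0"
        using assms(4) by (auto simp: upd un)
    qed
    then show ?thesis
      using assms(4) by (simp add: f linear_upd[OF un(1)] linear_upd[OF un(2)] sum.distrib sum_subtractf
          del: fun_upd_apply) (simp add: algebra_simps)
  qed
  then have "4 * 2 ^ n * fhat n m J h g T = 0"
    unfolding fhat_second_difference[OF assms(1-4)] by simp
  then show False using assms(5) by simp
qed

lemma mrf_nbhd_common_latent:
  assumes "i \<in> mrf_nbhd n m J h g u"
  obtains j where "j < m" "J u j \<noteq> 0" "J i j \<noteq> 0"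
  using assms fhat_nonzero_common_latent[of _ n u i m J h g] unfolding mrf_nbhd_def by blast

text \<open>Once these latent spins are fixed, the spins in the neighborhood are independent of each
  other and of the remaining observed spins.\<close>

definition nbhd_latents :: "nat \<Rightarrow> nat \<Rightarrow> (nat \<Rightarrow> nat \<Rightarrow> real) \<Rightarrow> (nat \<Rightarrow> real) \<Rightarrow> (nat \<Rightarrow> real)
    \<Rightarrow> nat \<Rightarrow> nat set" where
  "nbhd_latents n m J h g u = {j\<in>{0..<m}. \<exists>i\<in>mrf_nbhd n m J h g u. J i j \<noteq> 0}"

lemma finite_mrf_nbhd [simp]: "finite (mrf_nbhd n m J h g u)"
  by (simp add: mrf_nbhd_def)

lemma card_nbhd_latents_le: "u < n \<Longrightarrow> card (nbhd_latents n m J h g u) \<le> rbm_s n m J h g"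
  unfolding rbm_s_def nbhd_latents_def by (intro Max_ge) auto

lemma card_mrf_nbhd_le: "u < n \<Longrightarrow> card (mrf_nbhd n m J h g u) \<le> rbm_D n m J h g"
  unfolding rbm_D_def by (intro Max_ge) auto

lemma card_latent_support_le: "j < m \<Longrightarrow> card {i\<in>{0..<n}. J i j \<noteq> 0} \<le> rbm_d n m J"
  unfolding rbm_d_def by (intro Max_ge) auto

lemma rbm_d_ge_2:
  assumes "i \<in> mrf_nbhd n m J h g u" "u < n"
  shows "2 \<le> rbm_d n m J"
proof -
  obtain j where j: "j < m" "J u j \<noteq> 0" "J i j \<noteq> 0"
    using assms(1) by (rule mrf_nbhd_common_latent)
  have i: "i < n" "i \<noteq> u"
    using assms(1) by (auto simp: mrf_nbhd_def)
  have "card {u, i} \<le> card {i\<in>{0..<n}. J i j \<noteq> 0}"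
    using j i assms(2) by (intro card_mono) auto
  then show ?thesis
    using card_latent_support_le[OF j(1), of n J] i by simp
qed

lemma rbm_s_ge_1:
  assumes "i \<in> mrf_nbhd n m J h g u" "u < n"
  shows "1 \<le> rbm_s n m J h g"
proof -
  obtain j where "j < m" "J i j \<noteq> 0"
    using assms(1) by (rule mrf_nbhd_common_latent)
  then have "j \<in> nbhd_latents n m J h g u"
    using assms(1) by (auto simp: nbhd_latents_def)
  then have "0 < card (nbhd_latents n m J h g u)"
    by (auto simp: card_gt_0_iff nbhd_latents_def)
  then show ?thesis using card_nbhd_latents_le[OF assms(2), of m J h g] by simp
qed

text \<open>The supports of the latent variables in \<open>nbhd_latents\<close> cover the
  neighborhood: there are at most s of them, each of size at most d. This later trades powers of 2
  with exponent D for powers of d.\<close>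

lemma rbm_D_le: "rbm_D n m J h g \<le> rbm_s n m J h g * rbm_d n m J"
  unfolding rbm_D_def
proof (rule Max.boundedI)
  fix c assume "c \<in> insert 0 ((\<lambda>u. card (mrf_nbhd n m J h g u)) ` {0..<n})"
  then consider "c = 0" | u where "u < n" "c = card (mrf_nbhd n m J h g u)"
    by auto
  then show "c \<le> rbm_s n m J h g * rbm_d n m J"
  proof cases
    case (2 u)
    let ?H = "nbhd_latents n m J h g u"
    have fin: "finite ?H" by (simp add: nbhd_latents_def)
    have "mrf_nbhd n m J h g u \<subseteq> (\<Union>j\<in>?H. {i\<in>{0..<n}. J i j \<noteq> 0})"
    proof
      fix i assume i: "i \<in> mrf_nbhd n m J h g u"
      then obtain j where "j < m" "J i j \<noteq> 0"
        by (rule mrf_nbhd_common_latent)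
      with i show "i \<in> (\<Union>j\<in>?H. {i\<in>{0..<n}. J i j \<noteq> 0})"
        by (auto simp: nbhd_latents_def mrf_nbhd_def)
    qed
    then have "card (mrf_nbhd n m J h g u) \<le> card (\<Union>j\<in>?H. {i\<in>{0..<n}. J i j \<noteq> 0})"
      using fin by (intro card_mono) auto
    also have "\<dots> \<le> (\<Sum>j\<in>?H. card {i\<in>{0..<n}. J i j \<noteq> 0})"
      by (rule card_UN_le[OF fin])
    also have "\<dots> \<le> card ?H * rbm_d n m J"
    proof -
      have "(\<Sum>j\<in>?H. card {i\<in>{0..<n}. J i j \<noteq> 0}) \<le> (\<Sum>j\<in>?H. rbm_d n m J)"
        by (intro sum_mono card_latent_support_le) (simp add: nbhd_latents_def)
      then show ?thesis by simp
    qed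
    also have "\<dots> \<le> rbm_s n m J h g * rbm_d n m J"
      using card_nbhd_latents_le[OF 2(1)] by simp
    finally show ?thesis using 2 by simp
  qed simp
qed auto

section \<open>Weighted sums over cylinders\<close>

definition cylinder :: "nat \<Rightarrow> nat set \<Rightarrow> (nat \<Rightarrow> real) \<Rightarrow> (nat \<Rightarrow> real) set" where
  "cylinder n A \<sigma> = {x\<in>cube {0..<n}. \<forall>i\<in>A. x i = \<sigma> i}"

text \<open>The weight \<open>F\<close> is kept general to cover both \<open>rbm_P\<close> and the
  weights \<open>latent_joint\<close> with fixed latent spins.\<close>

definition cyl_sum :: "nat \<Rightarrow> ((nat \<Rightarrow> real) \<Rightarrow> real) \<Rightarrow> nat set \<Rightarrow> (nat \<Rightarrow> real) \<Rightarrow> real" where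
  "cyl_sum n F A \<sigma> = (\<Sum>x\<in>cylinder n A \<sigma>. F x)"

lemma finite_cylinder [simp]: "finite (cylinder n A \<sigma>)"
  by (simp add: cylinder_def)

lemma rbm_prob_eq_cyl_sum: "rbm_prob n m J h g A \<sigma> = cyl_sum n (rbm_P n m J h g) A \<sigma>"
  by (simp add: rbm_prob_def cyl_sum_def cylinder_def)

lemma cyl_sum_cong: "(\<And>i. i \<in> A \<Longrightarrow> \<sigma> i = \<sigma>' i) \<Longrightarrow> cyl_sum n F A \<sigma> = cyl_sum n F A \<sigma>'"
  unfolding cyl_sum_def cylinder_def by (intro sum.cong) auto

lemma cyl_sum_split:
  assumes "i < n" "i \<notin> A" "r = 1 \<or> r = -1"
  shows "cyl_sum n F A \<sigma> = cyl_sum n F (insert i A) (\<sigma>(i := r)) + cyl_sum n F (insert i A) (\<sigma>(i := - r))"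
proof -
  have "cylinder n A \<sigma> = cylinder n (insert i A) (\<sigma>(i := r)) \<union> cylinder n (insert i A) (\<sigma>(i := - r))"
  proof (intro set_eqI iffI)
    fix x assume x: "x \<in> cylinder n A \<sigma>"
    then have "x i = 1 \<or> x i = -1"
      using assms(1) by (intro cube_values) (auto simp: cylinder_def)
    then have "x i = r \<or> x i = - r"
      using assms(3) by auto
    then show "x \<in> cylinder n (insert i A) (\<sigma>(i := r)) \<union> cylinder n (insert i A) (\<sigma>(i := - r))"
      using x assms(2) by (auto simp: cylinder_def)
  qed (use assms(2) in \<open>auto simp: cylinder_def split: if_splits\<close>)
  moreover have "cylinder n (insert i A) (\<sigma>(i := r)) \<inter> cylinder n (insert i A) (\<sigma>(i := - r)) = {}"
    using assms(3) by (auto simp: cylinder_def)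
  ultimately show ?thesis
    unfolding cyl_sum_def by (simp add: sum.union_disjoint)
qed

text \<open>Both spins at \<open>i\<close> are indexed by the same cylinder, the one with spin 1, so
  that they can be compared term by term.\<close>

lemma cyl_sum_upd:
  assumes "i < n" "i \<notin> A" "r = 1 \<or> r = -1"
  shows "cyl_sum n F (insert i A) (\<sigma>(i := r)) = (\<Sum>x\<in>cylinder n (insert i A) (\<sigma>(i := 1)). F (x(i := r)))"
  unfolding cyl_sum_def
proof (rule sum.reindex_bij_witness[of _ "\<lambda>x. x(i := r)" "\<lambda>x. x(i := 1)"])
  fix x assume x: "x \<in> cylinder n (insert i A) (\<sigma>(i := r))"
  then show "x(i := 1) \<in> cylinder n (insert i A) (\<sigma>(i := 1))"
    using assms by (auto simp: cylinder_def cube_upd)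
  show "x(i := 1, i := r) = x"
    using x by (auto simp: cylinder_def)
  then show "F (x(i := 1, i := r)) = F x" by simp
next
  fix x assume "x \<in> cylinder n (insert i A) (\<sigma>(i := 1))"
  then show "x(i := r, i := 1) = x" "x(i := r) \<in> cylinder n (insert i A) (\<sigma>(i := r))"
    using assms by (auto simp: cylinder_def cube_upd)
qed

lemma cyl_sum_ratio:
  assumes "i < n" "i \<notin> A"
    and "\<And>x. x \<in> cylinder n A \<sigma> \<Longrightarrow> F (x(i := 1)) = \<kappa> * F (x(i := -1))"
  shows "cyl_sum n F (insert i A) (\<sigma>(i := 1)) = \<kappa> * cyl_sum n F (insert i A) (\<sigma>(i := -1))"
proof -
  have "x \<in> cylinder n A \<sigma>" if "x \<in> cylinder n (insert i A) (\<sigma>(i := 1))" for x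
    using that assms(2) by (auto simp: cylinder_def split: if_splits)
  then show ?thesis
    using assms by (subst (1 2) cyl_sum_upd) (auto simp: sum_distrib_left intro!: sum.cong)
qed

text \<open>Probability of the spin r when the odds of 1 against -1 are \<open>\<kappa>\<close>.\<close>
definition spin_weight :: "real \<Rightarrow> real \<Rightarrow> real" where
  "spin_weight \<kappa> r = (if r = 1 then \<kappa> / (1 + \<kappa>) else 1 / (1 + \<kappa>))"

text \<open>Odds that are constant on the cylinder make the spin independent of the rest. This
  serves twice: for neighbors once the latent spins are fixed, and for \<open>u\<close> once its
  neighborhood is fixed.\<close>

lemma cyl_sum_insert:
  assumes "i < n" "i \<notin> A" "\<sigma> i = 1 \<or> \<sigma> i = -1" "\<kappa> > 0"
    and "\<And>x. x \<in> cylinder n A \<sigma> \<Longrightarrow> F (x(i := 1)) = \<kappa> * F (x(i := -1))"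
  shows "cyl_sum n F (insert i A) \<sigma> = spin_weight \<kappa> (\<sigma> i) * cyl_sum n F A \<sigma>"
proof -
  have plus: "cyl_sum n F (insert i A) (\<sigma>(i := 1)) = \<kappa> * cyl_sum n F (insert i A) (\<sigma>(i := -1))"
    by (rule cyl_sum_ratio[OF assms(1,2,5)])
  have total: "cyl_sum n F A \<sigma> = (1 + \<kappa>) * cyl_sum n F (insert i A) (\<sigma>(i := -1))"
    using cyl_sum_split[OF assms(1,2), of 1] plus by (simp add: ring_distribs)
  have "\<sigma>(i := \<sigma> i) = \<sigma>" "1 + \<kappa> \<noteq> 0"
    using assms(4) by auto
  then show ?thesis
    unfolding total using assms(3) plus by (elim disjE) (auto simp: spin_weight_def)
qed

lemma cyl_sum_le:
  assumes "i < n" "i \<notin> A" "r = 1 \<or> r = -1"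
    and "\<And>x. x \<in> cube {0..<n} \<Longrightarrow> F (x(i := r)) \<le> K * F (x(i := - r))"
  shows "cyl_sum n F (insert i A) (\<sigma>(i := r)) \<le> K * cyl_sum n F (insert i A) (\<sigma>(i := - r))"
proof -
  have "- r = 1 \<or> - r = -1" using assms(3) by auto
  from cyl_sum_upd[OF assms(1,2) this] cyl_sum_upd[OF assms(1-3)] assms(4)
  show ?thesis
    by (auto simp: sum_distrib_left cylinder_def intro!: sum_mono)
qed

text \<open>The cylinder over \<open>A\<close> is partitioned by the restriction to
  \<open>S\<close>. Since \<open>A\<close> may meet \<open>S\<close>, only those
  \<open>\<tau>\<close> compatible with \<open>\<sigma>\<close> occur.\<close>

lemma cyl_sum_marginal:
  assumes "S \<subseteq> {0..<n}"
  shows "(\<Sum>\<tau>\<in>{\<tau>\<in>cube S. \<forall>i\<in>S \<inter> A. \<tau> i = \<sigma> i}. cyl_sum n F (A \<union> S) (\<lambda>i. if i \<in> S then \<tau> i else \<sigma> i))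
    = cyl_sum n F A \<sigma>"
proof -
  let ?T = "{\<tau>\<in>cube S. \<forall>i\<in>S \<inter> A. \<tau> i = \<sigma> i}"
  have "finite S" using assms finite_subset by blast
  then have fin: "finite ?T" by simp
  have "{x \<in> cylinder n A \<sigma>. restrict x S = \<tau>} = cylinder n (A \<union> S) (\<lambda>i. if i \<in> S then \<tau> i else \<sigma> i)"
    if "\<tau> \<in> ?T" for \<tau>
  proof -
    have ext: "\<tau> \<in> extensional S" using that by (auto simp: cube_def PiE_def)
    have "restrict x S = \<tau> \<longleftrightarrow> (\<forall>i\<in>S. x i = \<tau> i)" for x
      using ext by (auto simp: fun_eq_iff extensional_def)
    then show ?thesis using that by (auto simp: cylinder_def)
  qed
  then have "(\<Sum>\<tau>\<in>?T. cyl_sum n F (A \<union> S) (\<lambda>i. if i \<in> S then \<tau> i else \<sigma> i))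
      = (\<Sum>\<tau>\<in>?T. \<Sum>x\<in>{x \<in> cylinder n A \<sigma>. restrict x S = \<tau>}. F x)"
    unfolding cyl_sum_def by (intro sum.cong) auto
  also have "\<dots> = cyl_sum n F A \<sigma>"
    unfolding cyl_sum_def
    using assms by (intro sum.group[OF finite_cylinder fin]) (auto simp: cylinder_def intro: restrict_cube)
  finally show ?thesis .
qed

section \<open>Lower bounds for marginal probabilities\<close>

lemma cube_nonempty: "cube A \<noteq> {}"
  by (auto simp: cube_def PiE_eq_empty_iff)

lemma rbm_partition_pos: "0 < (\<Sum>y\<in>cube {0..<n}. exp (rbm_f n m J h g y))"
  by (intro sum_pos) (auto simp: cube_nonempty)

lemma rbm_P_pos: "0 < rbm_P n m J h g x"
  unfolding rbm_P_def by (simp add: rbm_partition_pos)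

lemma rbm_prob_empty: "rbm_prob n m J h g {} \<sigma> = 1"
  using rbm_partition_pos[of n m J h g]
  by (simp add: rbm_prob_def rbm_P_def flip: sum_divide_distrib)

lemma rbm_P_upd_ratio:
  "rbm_P n m J h g (x(i := 1))
    = exp (rbm_f n m J h g (x(i := 1)) - rbm_f n m J h g (x(i := -1))) * rbm_P n m J h g (x(i := -1))"
  by (simp add: rbm_P_def exp_diff)

lemma rbm_gamma_nonneg:
  assumes "u < n"
  shows "0 \<le> rbm_gamma n m J h g"
proof -
  obtain x where "x \<in> cube {0..<n}"
    using cube_nonempty by blast
  from rbm_f_diff_le_gamma[OF this assms, of m J h g] show ?thesis by linarith
qed

lemma rbm_P_flip_le:
  assumes "x \<in> cube {0..<n}" "i < n" "r = 1 \<or> r = -1"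
  shows "rbm_P n m J h g (x(i := r)) \<le> exp (2 * rbm_gamma n m J h g) * rbm_P n m J h g (x(i := - r))"
proof -
  have "rbm_f n m J h g (x(i := r)) \<le> 2 * rbm_gamma n m J h g + rbm_f n m J h g (x(i := - r))"
    using rbm_f_diff_le_gamma[OF assms(1,2), of m J h g] assms(3) by auto
  then have "exp (rbm_f n m J h g (x(i := r))) \<le> exp (2 * rbm_gamma n m J h g) * exp (rbm_f n m J h g (x(i := - r)))"
    by (simp flip: exp_add)
  then show ?thesis
    using rbm_partition_pos[of n m J h g] by (simp add: rbm_P_def divide_right_mono)
qed

lemma rbm_prob_flip_le:
  assumes "i < n" "i \<notin> A" "r = 1 \<or> r = -1"
  shows "rbm_prob n m J h g (insert i A) (\<sigma>(i := r))
    \<le> exp (2 * rbm_gamma n m J h g) * rbm_prob n m J h g (insert i A) (\<sigma>(i := - r))"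
  unfolding rbm_prob_eq_cyl_sum using assms by (intro cyl_sum_le rbm_P_flip_le) auto

text \<open>Flipping one spin changes a probability by a factor of at most
  \<open>exp (2 * \<gamma>)\<close>, and this factor is at least 1; hence each spin value keeps a
  share of at least \<open>exp (- 2 * \<gamma>) / 2\<close>.\<close>

lemma rbm_prob_insert_ge:
  assumes "i < n" "i \<notin> A" "\<sigma> i = 1 \<or> \<sigma> i = -1"
  shows "exp (- 2 * rbm_gamma n m J h g) / 2 * rbm_prob n m J h g A \<sigma> \<le> rbm_prob n m J h g (insert i A) \<sigma>"
proof -
  let ?E = "exp (2 * rbm_gamma n m J h g)"
  let ?p = "rbm_prob n m J h g (insert i A) \<sigma>"
  have r: "- \<sigma> i = 1 \<or> - \<sigma> i = -1" using assms(3) by auto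
  have p0: "0 \<le> ?p"
    unfolding rbm_prob_def by (intro sum_nonneg less_imp_le rbm_P_pos)
  have "rbm_prob n m J h g A \<sigma> = ?p + rbm_prob n m J h g (insert i A) (\<sigma>(i := - \<sigma> i))"
    unfolding rbm_prob_eq_cyl_sum using cyl_sum_split[OF assms(1,2,3), of _ \<sigma>] by simp
  also have "\<dots> \<le> ?p + ?E * ?p"
    using rbm_prob_flip_le[OF assms(1,2) r, of m J h g \<sigma>] by simp
  also have "\<dots> \<le> 2 * ?E * ?p"
    using mult_right_mono[OF _ p0, of 1 ?E] rbm_gamma_nonneg[OF assms(1), of m J h g]
    by (simp add: mult.commute)
  finally have "exp (- 2 * rbm_gamma n m J h g) / 2 * rbm_prob n m J h g A \<sigma>
      \<le> exp (- 2 * rbm_gamma n m J h g) / 2 * (2 * ?E * ?p)"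
    by (intro mult_left_mono) auto
  also have "\<dots> = ?p" by (simp add: exp_minus)
  finally show ?thesis .
qed

lemma rbm_prob_ge:
  assumes "A \<subseteq> {0..<n}" "\<And>i. i \<in> A \<Longrightarrow> \<sigma> i = 1 \<or> \<sigma> i = -1"
  shows "(exp (- 2 * rbm_gamma n m J h g) / 2) ^ card A \<le> rbm_prob n m J h g A \<sigma>"
proof -
  have "finite A" using assms(1) finite_subset by blast
  then show ?thesis
    using assms
  proof (induction A rule: finite_induct)
    case (insert i A)
    let ?e = "exp (- 2 * rbm_gamma n m J h g) / 2"
    have "?e ^ card (insert i A) = ?e * ?e ^ card A"
      using insert.hyps by simp
    also have "\<dots> \<le> ?e * rbm_prob n m J h g A \<sigma>"
      using insert by (intro mult_left_mono insert.IH) auto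
    also have "\<dots> \<le> rbm_prob n m J h g (insert i A) \<sigma>"
      using insert by (intro rbm_prob_insert_ge) auto
    finally show ?case .
  qed (simp add: rbm_prob_empty)
qed

lemma rbm_prob_pos:
  assumes "A \<subseteq> {0..<n}" "\<And>i. i \<in> A \<Longrightarrow> \<sigma> i = 1 \<or> \<sigma> i = -1"
  shows "0 < rbm_prob n m J h g A \<sigma>"
  by (rule less_le_trans[OF _ rbm_prob_ge[OF assms]]) auto

section \<open>Conditional independence given the latent spins\<close>

text \<open>Joint law of the observed spins and the latent spins in H, the other latent ones summed out.\<close>
definition latent_joint :: "nat \<Rightarrow> nat \<Rightarrow> (nat \<Rightarrow> nat \<Rightarrow> real) \<Rightarrow> (nat \<Rightarrow> real) \<Rightarrow> (nat \<Rightarrow> real)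
    \<Rightarrow> nat set \<Rightarrow> (nat \<Rightarrow> real) \<Rightarrow> (nat \<Rightarrow> real) \<Rightarrow> real" where
  "latent_joint n m J h g H y x =
     exp (\<Sum>i<n. h i * x i) * (\<Prod>j\<in>{..<m} - H. exp (rho ((\<Sum>i<n. J i j * x i) + g j))) *
     (\<Prod>j\<in>H. exp (y j * ((\<Sum>i<n. J i j * x i) + g j))) /
     (\<Sum>z\<in>cube {0..<n}. exp (rbm_f n m J h g z))"

text \<open>\<open>exp (rho a)\<close> is the sum of \<open>exp (r * a)\<close> over the two spins r
  of a latent variable; the product of these sums over \<open>H\<close> expands into a sum over
  \<open>cube H\<close>.\<close>

lemma sum_latent_joint:
  assumes "H \<subseteq> {..<m}"
  shows "(\<Sum>y\<in>cube H. latent_joint n m J h g H y x) = rbm_P n m J h g x"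
proof -
  define t where "t j = (\<Sum>i<n. J i j * x i) + g j" for j
  have fin: "finite H" using assms finite_subset by blast
  have "exp (rho a) = (\<Sum>r\<in>{-1, 1}. exp (r * a))" for a
    by (simp add: rho_def add_pos_pos)
  then have "(\<Prod>j\<in>H. exp (rho (t j))) = (\<Sum>y\<in>cube H. \<Prod>j\<in>H. exp (y j * t j))"
    unfolding cube_def by (simp only:) (rule prod_sum_PiE, use fin in auto)
  moreover have "(\<Prod>j<m. exp (rho (t j))) = (\<Prod>j\<in>{..<m} - H. exp (rho (t j))) * (\<Prod>j\<in>H. exp (rho (t j)))"
    by (rule prod.subset_diff[OF assms]) simp
  moreover have "exp (rbm_f n m J h g x) = exp (\<Sum>i<n. h i * x i) * (\<Prod>j<m. exp (rho (t j)))"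
    by (simp add: rbm_f_def exp_add exp_sum t_def)
  ultimately show ?thesis
    unfolding latent_joint_def rbm_P_def
    by (simp add: mult.assoc flip: t_def sum_divide_distrib sum_distrib_left)
qed

text \<open>With the spins in \<open>H\<close> fixed, the exponent is linear in the spin
  \<open>i\<close>, so its odds depend on \<open>y\<close> but not on the other observed
  spins.\<close>

lemma latent_joint_upd_ratio:
  assumes "i < n" "finite H" "\<And>j. j < m \<Longrightarrow> j \<notin> H \<Longrightarrow> J i j = 0"
  shows "latent_joint n m J h g H y (x(i := 1))
    = exp (2 * (h i + (\<Sum>j\<in>H. y j * J i j))) * latent_joint n m J h g H y (x(i := -1))"
proof -
  have rest: "(\<Prod>j\<in>{..<m} - H. exp (rho ((\<Sum>l<n. J l j * (x(i := r)) l) + g j)))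
      = (\<Prod>j\<in>{..<m} - H. exp (rho ((\<Sum>l<n. J l j * x l) + g j)))" for r
  proof (intro prod.cong refl)
    fix j assume "j \<in> {..<m} - H"
    then show "exp (rho ((\<Sum>l<n. J l j * (x(i := r)) l) + g j)) = exp (rho ((\<Sum>l<n. J l j * x l) + g j))"
      using linear_upd[OF assms(1), of "\<lambda>l. J l j" x r] assms(3)[of j] by simp
  qed
  have "(\<Prod>j\<in>H. exp (y j * ((\<Sum>l<n. J l j * (x(i := 1)) l) + g j)))
      = (\<Prod>j\<in>H. exp (2 * (y j * J i j)) * exp (y j * ((\<Sum>l<n. J l j * (x(i := -1)) l) + g j)))"
  proof (intro prod.cong refl)
    fix j
    have "y j * ((\<Sum>l<n. J l j * (x(i := 1)) l) + g j)
        = 2 * (y j * J i j) + y j * ((\<Sum>l<n. J l j * (x(i := -1)) l) + g j)"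
      unfolding linear_upd[OF assms(1), of "\<lambda>l. J l j" x] by (simp add: algebra_simps)
    then show "exp (y j * ((\<Sum>l<n. J l j * (x(i := 1)) l) + g j))
        = exp (2 * (y j * J i j)) * exp (y j * ((\<Sum>l<n. J l j * (x(i := -1)) l) + g j))"
      by (simp add: exp_add)
  qed
  also have "\<dots> = exp (2 * (\<Sum>j\<in>H. y j * J i j))
      * (\<Prod>j\<in>H. exp (y j * ((\<Sum>l<n. J l j * (x(i := -1)) l) + g j)))"
    using assms(2) by (simp add: prod.distrib exp_sum sum_distrib_left)
  finally have touched: "(\<Prod>j\<in>H. exp (y j * ((\<Sum>l<n. J l j * (x(i := 1)) l) + g j)))
      = exp (2 * (\<Sum>j\<in>H. y j * J i j))
      * (\<Prod>j\<in>H. exp (y j * ((\<Sum>l<n. J l j * (x(i := -1)) l) + g j)))" .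
  have "(\<Sum>l<n. h l * (x(i := 1)) l) = 2 * h i + (\<Sum>l<n. h l * (x(i := -1)) l)"
    unfolding linear_upd[OF assms(1), of h x] by (simp add: algebra_simps)
  then show ?thesis
    unfolding latent_joint_def rest touched by (simp add: exp_add distrib_left)
qed

lemma latent_joint_cyl_sum_union:
  assumes "finite I" "I \<subseteq> {0..<n}" "finite H" "I \<inter> A = {}"
    and "\<And>i. i \<in> I \<Longrightarrow> \<sigma> i = 1 \<or> \<sigma> i = -1"
    and "\<And>i j. i \<in> I \<Longrightarrow> j < m \<Longrightarrow> j \<notin> H \<Longrightarrow> J i j = 0"
  shows "cyl_sum n (latent_joint n m J h g H y) (A \<union> I) \<sigma>
    = cyl_sum n (latent_joint n m J h g H y) A \<sigma> *
      (\<Prod>i\<in>I. spin_weight (exp (2 * (h i + (\<Sum>j\<in>H. y j * J i j)))) (\<sigma> i))"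
  using assms
proof (induction I rule: finite_induct)
  case (insert i I)
  have "cyl_sum n (latent_joint n m J h g H y) (insert i (A \<union> I)) \<sigma>
    = spin_weight (exp (2 * (h i + (\<Sum>j\<in>H. y j * J i j)))) (\<sigma> i) * cyl_sum n (latent_joint n m J h g H y) (A \<union> I) \<sigma>"
    using insert by (intro cyl_sum_insert latent_joint_upd_ratio) auto
  then show ?case
    using insert by simp
qed simp

text \<open>A mixture of product laws: \<open>\<sigma>\<close> on \<open>A\<close> enters only the
  weights, \<open>\<sigma>\<close> on \<open>I\<close> only the factors.\<close>

lemma rbm_prob_union_mixture:
  assumes "I \<subseteq> {0..<n}" "H \<subseteq> {..<m}" "I \<inter> A = {}"
    and "\<And>i. i \<in> I \<Longrightarrow> \<sigma> i = 1 \<or> \<sigma> i = -1"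
    and "\<And>i j. i \<in> I \<Longrightarrow> j < m \<Longrightarrow> j \<notin> H \<Longrightarrow> J i j = 0"
  shows "rbm_prob n m J h g (A \<union> I) \<sigma>
    = (\<Sum>y\<in>cube H. cyl_sum n (latent_joint n m J h g H y) A \<sigma> *
        (\<Prod>i\<in>I. spin_weight (exp (2 * (h i + (\<Sum>j\<in>H. y j * J i j)))) (\<sigma> i)))"
proof -
  have fin: "finite I" "finite H" using assms finite_subset by blast+
  have "rbm_prob n m J h g (A \<union> I) \<sigma> = (\<Sum>y\<in>cube H. cyl_sum n (latent_joint n m J h g H y) (A \<union> I) \<sigma>)"
    unfolding rbm_prob_eq_cyl_sum cyl_sum_def
    by (subst sum.swap) (simp add: sum_latent_joint[OF assms(2)])
  then show ?thesis
    using latent_joint_cyl_sum_union[where I=I and A=A and \<sigma>=\<sigma> and n=n and m=m and J=J and h=h and g=g and H=H] assms fin by simp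
qed

section \<open>Dependence between u and sets of observed spins\<close>

definition glue :: "nat set \<Rightarrow> (nat \<Rightarrow> real) \<Rightarrow> (nat \<Rightarrow> real) \<Rightarrow> nat \<Rightarrow> real" where
  "glue S \<tau> x i = (if i \<in> S then \<tau> i else x i)"

text \<open>This is P(S) times the difference of conditional probabilities in \<open>nu\<close>,
  cleared of denominators except in a coefficient free of \<open>I\<close>. It is therefore linear
  in the two probabilities that involve \<open>I\<close>.\<close>

definition rbm_dep :: "nat \<Rightarrow> nat \<Rightarrow> (nat \<Rightarrow> nat \<Rightarrow> real) \<Rightarrow> (nat \<Rightarrow> real) \<Rightarrow> (nat \<Rightarrow> real)
    \<Rightarrow> nat \<Rightarrow> nat set \<Rightarrow> nat set \<Rightarrow> (nat \<Rightarrow> real) \<Rightarrow> real" where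
  "rbm_dep n m J h g u I S \<sigma> = rbm_prob n m J h g (insert u S \<union> I) \<sigma>
     - rbm_prob n m J h g (insert u S) \<sigma> / rbm_prob n m J h g S \<sigma> * rbm_prob n m J h g (S \<union> I) \<sigma>"

lemma rbm_prob_cong: "(\<And>i. i \<in> A \<Longrightarrow> \<sigma> i = \<sigma>' i) \<Longrightarrow> rbm_prob n m J h g A \<sigma> = rbm_prob n m J h g A \<sigma>'"
  unfolding rbm_prob_eq_cyl_sum by (rule cyl_sum_cong)

text \<open>\<open>nu\<close> averages nonnegative terms over R and G; the term with R = 1 and G
  given by \<open>x\<close> has weight \<open>1 / 2 ^ (card I + 1)\<close>, and the others are
  dropped.\<close>

lemma nu_ge_dep_sum:
  assumes "S \<subseteq> {0..<n} - {u}" "I \<subseteq> {0..<n} - {u}" "I \<inter> S = {}"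
    and "\<And>i. i \<in> I \<Longrightarrow> x i = 1 \<or> x i = -1" "x u = 1"
  shows "(\<Sum>\<tau>\<in>cube S. \<bar>rbm_dep n m J h g u I S (glue S \<tau> x)\<bar>) / 2 ^ (card I + 1) \<le> nu n m J h g u I S"
proof -
  define K where "K R G = (1 / 2) * (1 / 2 ^ card I) *
        (\<Sum>\<tau>\<in>cube S. rbm_prob n m J h g S \<tau> *
           \<bar>rbm_cond n m J h g ({u} \<union> I) (G(u := R)) S \<tau>
            - rbm_cond n m J h g {u} (\<lambda>_. R) S \<tau> * rbm_cond n m J h g I G S \<tau>\<bar>)" for R :: real and G
  let ?G = "restrict x I"
  have fin: "finite I" "finite S"
    using finite_subset[OF assms(2)] finite_subset[OF assms(1)] by auto
  have prob_nonneg: "0 \<le> rbm_prob n m J h g A \<sigma>" for A \<sigma>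
    unfolding rbm_prob_def by (intro sum_nonneg less_imp_le rbm_P_pos)
  have K0: "0 \<le> K R G" for R G
    unfolding K_def by (intro mult_nonneg_nonneg sum_nonneg) (auto simp: prob_nonneg)
  have "rbm_prob n m J h g S \<tau> *
           \<bar>rbm_cond n m J h g ({u} \<union> I) (?G(u := 1)) S \<tau>
            - rbm_cond n m J h g {u} (\<lambda>_. 1) S \<tau> * rbm_cond n m J h g I ?G S \<tau>\<bar>
      = \<bar>rbm_dep n m J h g u I S (glue S \<tau> x)\<bar>" if "\<tau> \<in> cube S" for \<tau>
  proof -
    define p where "p = rbm_prob n m J h g S \<tau>"
    have p: "0 < p"
      unfolding p_def using assms(1) cube_values[OF that] by (intro rbm_prob_pos) auto
    have 1: "rbm_prob n m J h g S (glue S \<tau> x) = p"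
      unfolding p_def by (rule rbm_prob_cong) (simp add: glue_def)
    have 2: "rbm_prob n m J h g (({u} \<union> I) \<union> S) (\<lambda>i. if i \<in> {u} \<union> I then (?G(u := 1)) i else \<tau> i)
        = rbm_prob n m J h g (insert u S \<union> I) (glue S \<tau> x)" (is "_ = ?a")
    proof -
      have "({u} \<union> I) \<union> S = insert u S \<union> I" by auto
      then show ?thesis
        using assms by (auto simp: glue_def intro!: rbm_prob_cong)
    qed
    have 3: "rbm_prob n m J h g ({u} \<union> S) (\<lambda>i. if i \<in> {u} then 1 else \<tau> i)
        = rbm_prob n m J h g (insert u S) (glue S \<tau> x)" (is "_ = ?b")
      using assms by (auto simp: glue_def intro!: rbm_prob_cong)
    have 4: "rbm_prob n m J h g (I \<union> S) (\<lambda>i. if i \<in> I then ?G i else \<tau> i)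
        = rbm_prob n m J h g (S \<union> I) (glue S \<tau> x)" (is "_ = ?c")
      using assms by (auto simp: glue_def Un_commute intro!: rbm_prob_cong)
    have "p * \<bar>?a / p - ?b / p * (?c / p)\<bar> = \<bar>p * (?a / p - ?b / p * (?c / p))\<bar>"
      using p by (simp add: abs_mult)
    also have "p * (?a / p - ?b / p * (?c / p)) = ?a - ?b / p * ?c"
      using p by (simp add: field_simps)
    finally show ?thesis
      unfolding rbm_cond_def rbm_dep_def 1 2 3 4 p_def[symmetric] .
  qed
  then have "(\<Sum>\<tau>\<in>cube S. \<bar>rbm_dep n m J h g u I S (glue S \<tau> x)\<bar>) / 2 ^ (card I + 1) = K 1 ?G"
    unfolding K_def by simp
  also have "\<dots> \<le> (\<Sum>G\<in>cube I. K 1 G)"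
  proof (rule member_le_sum)
    show "?G \<in> cube I"
      using assms(4) by (fastforce simp: cube_def)
  qed (use fin K0 in auto)
  also have "\<dots> \<le> (\<Sum>R\<in>{-1, 1}. \<Sum>G\<in>cube I. K R G)"
    using sum_nonneg[of "cube I" "K (-1)"] K0 by simp
  also have "\<dots> = nu n m J h g u I S"
    unfolding nu_def K_def ..
  finally show ?thesis .
qed

lemma rbm_dep_mixture:
  assumes "I \<subseteq> {0..<n} - {u}" "I \<inter> S = {}" "H \<subseteq> {..<m}"
    and "\<And>i. i \<in> I \<Longrightarrow> \<sigma> i = 1 \<or> \<sigma> i = -1"
    and "\<And>i j. i \<in> I \<Longrightarrow> j < m \<Longrightarrow> j \<notin> H \<Longrightarrow> J i j = 0"
  shows "rbm_dep n m J h g u I S \<sigma> = (\<Sum>y\<in>cube H.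
     (cyl_sum n (latent_joint n m J h g H y) (insert u S) \<sigma>
       - rbm_prob n m J h g (insert u S) \<sigma> / rbm_prob n m J h g S \<sigma> * cyl_sum n (latent_joint n m J h g H y) S \<sigma>) *
     (\<Prod>i\<in>I. spin_weight (exp (2 * (h i + (\<Sum>j\<in>H. y j * J i j)))) (\<sigma> i)))"
proof -
  have "I \<subseteq> {0..<n}" "I \<inter> insert u S = {}" using assms by auto
  from rbm_prob_union_mixture[OF this(1) assms(3) this(2) assms(4,5), where g=g and h=h]
    rbm_prob_union_mixture[OF this(1) assms(3) assms(2) assms(4,5), where g=g and h=h]
  show ?thesis
    unfolding rbm_dep_def by (simp add: left_diff_distrib sum_subtractf sum_distrib_left mult.assoc)
qed

text \<open>\<open>prod_functional_bound\<close> is applied on the \<open>2 ^ card H\<close> points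
  of \<open>cube H\<close>, with the configurations \<open>\<tau>\<close> of \<open>S\<close> as the
  index of the weights.\<close>

lemma rbm_dep_subset:
  assumes "A \<subseteq> {0..<n} - {u}" "A \<inter> S = {}" "H \<subseteq> {..<m}"
    and "\<And>i. i \<in> A \<Longrightarrow> x i = 1 \<or> x i = -1"
    and "\<And>i j. i \<in> A \<Longrightarrow> j < m \<Longrightarrow> j \<notin> H \<Longrightarrow> J i j = 0"
  obtains I where "I \<subseteq> A" "card I \<le> 2 ^ card H - 1"
    "(\<Sum>\<tau>\<in>cube S. \<bar>rbm_dep n m J h g u A S (glue S \<tau> x)\<bar>)
      \<le> (2 * real (card A) + 1) ^ (2 ^ card H - 1) * (\<Sum>\<tau>\<in>cube S. \<bar>rbm_dep n m J h g u I S (glue S \<tau> x)\<bar>)"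
proof -
  define k :: nat where "k = 2 ^ card H - 1"
  define V where "V I = (\<Sum>\<tau>\<in>cube S. \<bar>rbm_dep n m J h g u I S (glue S \<tau> x)\<bar>)" for I
  \<comment> \<open>All dependence on \<open>\<tau>\<close> sits in \<open>q\<close>; as
    \<open>A\<close> avoids \<open>S\<close>, the factors \<open>p\<close> see only
    \<open>x\<close>.\<close>
  define q where "q \<tau> y = cyl_sum n (latent_joint n m J h g H y) (insert u S) (glue S \<tau> x)
       - rbm_prob n m J h g (insert u S) (glue S \<tau> x) / rbm_prob n m J h g S (glue S \<tau> x)
         * cyl_sum n (latent_joint n m J h g H y) S (glue S \<tau> x)" for \<tau> y
  define p where "p i y = spin_weight (exp (2 * (h i + (\<Sum>j\<in>H. y j * J i j)))) (x i)" for i y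
  have fin: "finite A" "finite H"
    using assms finite_subset[of A "{0..<n}"] finite_subset[of H] by auto
  have V: "V I = (\<Sum>\<tau>\<in>cube S. \<bar>\<Sum>y\<in>cube H. q \<tau> y * (\<Prod>i\<in>I. p i y)\<bar>)" if "I \<subseteq> A" for I
    unfolding V_def
  proof (intro sum.cong refl arg_cong[of _ _ abs])
    fix \<tau>
    have "glue S \<tau> x i = x i \<and> (x i = 1 \<or> x i = -1)" if "i \<in> I" for i
      using that \<open>I \<subseteq> A\<close> assms(2,4) by (auto simp: glue_def)
    then show "rbm_dep n m J h g u I S (glue S \<tau> x) = (\<Sum>y\<in>cube H. q \<tau> y * (\<Prod>i\<in>I. p i y))"
      unfolding q_def p_def using that assms
      by (subst rbm_dep_mixture[where H=H]) auto
  qed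
  let ?F = "{I. I \<subseteq> A \<and> card I \<le> k}"
  have finF: "finite (V ` ?F)" and neF: "V ` ?F \<noteq> {}"
    using fin by auto
  \<comment> \<open>A maximizer among the small subsets is taken, so that its value can play the
    part of \<open>\<epsilon>\<close>.\<close>
  from Max_in[OF finF neF] obtain I where I: "I \<in> ?F" "V I = Max (V ` ?F)" by auto
  have "V A \<le> (2 * real (card A) + 1) ^ k * V I"
    unfolding V[OF order_refl]
  proof (rule prod_functional_bound)
    show "card (cube H) = Suc k"
      using fin by (simp add: card_cube k_def)
    show "0 \<le> p i y \<and> p i y \<le> 1" for i y
      by (simp add: p_def spin_weight_def add_pos_pos)
    fix I' assume I': "I' \<subseteq> A" "card I' \<le> k"
    then have "V I' \<le> V I"
      unfolding I(2) using finF by (intro Max_ge) auto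
    then show "(\<Sum>\<tau>\<in>cube S. \<bar>\<Sum>y\<in>cube H. q \<tau> y * (\<Prod>i\<in>I'. p i y)\<bar>) \<le> V I"
      using V[OF I'(1)] by simp
  qed (use fin in auto)
  with I that show ?thesis
    by (auto simp: V_def k_def)
qed

section \<open>Dependence between u and its neighborhood outside S\<close>

lemma second_difference_eq:
  fixes f :: "(nat \<Rightarrow> real) \<Rightarrow> real"
  assumes "u \<noteq> i" "x u = 1 \<or> x u = -1" "x i = 1 \<or> x i = -1"
  shows "\<bar>f x - f (x(u := - x u)) - f (x(i := - x i)) + f (x(u := - x u, i := - x i))\<bar>
    = \<bar>(f (x(i := 1, u := 1)) - f (x(i := 1, u := -1))) - (f (x(i := -1, u := 1)) - f (x(i := -1, u := -1)))\<bar>"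
proof -
  define F where "F a b = f (x(i := b, u := a))" for a b
  have "f x = F (x u) (x i)" "f (x(u := - x u)) = F (- x u) (x i)" "f (x(i := - x i)) = F (x u) (- x i)"
    "f (x(u := - x u, i := - x i)) = F (- x u) (- x i)"
    using assms(1) by (auto simp: F_def fun_upd_twist intro!: arg_cong[of _ _ f])
  then show ?thesis
    using assms(2,3) unfolding F_def[symmetric] by (elim disjE) (simp_all add: abs_if)
qed

lemma rbm_alpha_le:
  assumes "T \<subseteq> {0..<n}" "fhat n m J h g T \<noteq> 0"
  shows "rbm_alpha n m J h g \<le> \<bar>fhat n m J h g T\<bar>"
proof -
  have "{\<bar>fhat n m J h g T\<bar> | T. T \<subseteq> {0..<n} \<and> fhat n m J h g T \<noteq> 0}
      \<subseteq> (\<lambda>T. \<bar>fhat n m J h g T\<bar>) ` Pow {0..<n}" by auto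
  then have "finite {\<bar>fhat n m J h g T\<bar> | T. T \<subseteq> {0..<n} \<and> fhat n m J h g T \<noteq> 0}"
    by (rule finite_subset) simp
  then show ?thesis
    unfolding rbm_alpha_def using assms by (intro Min_le) auto
qed

lemma rbm_alpha_pos:
  assumes "T \<subseteq> {0..<n}" "fhat n m J h g T \<noteq> 0"
  shows "0 < rbm_alpha n m J h g"
proof -
  let ?F = "{\<bar>fhat n m J h g T\<bar> | T. T \<subseteq> {0..<n} \<and> fhat n m J h g T \<noteq> 0}"
  have "?F \<subseteq> (\<lambda>T. \<bar>fhat n m J h g T\<bar>) ` Pow {0..<n}" by auto
  then have "finite ?F"
    by (rule finite_subset) simp
  moreover have "?F \<noteq> {}" using assms by auto
  ultimately show ?thesis
    unfolding rbm_alpha_def by (subst Min_gr_iff) auto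
qed

lemma rbm_alpha_le_gamma:
  assumes "T \<subseteq> {0..<n}" "u \<in> T" "fhat n m J h g T \<noteq> 0"
  shows "rbm_alpha n m J h g \<le> rbm_gamma n m J h g"
proof -
  have "rbm_alpha n m J h g \<le> \<bar>fhat n m J h g T\<bar>"
    by (rule rbm_alpha_le[OF assms(1,3)])
  also have "\<dots> \<le> (\<Sum>T\<in>{T. T \<subseteq> {0..<n} \<and> u \<in> T}. \<bar>fhat n m J h g T\<bar>)"
    using assms by (intro member_le_sum) auto
  also have "\<dots> \<le> rbm_gamma n m J h g"
    unfolding rbm_gamma_def using assms by (intro Max_ge) auto
  finally show ?thesis .
qed

text \<open>Four times the coefficient at \<open>T\<close> is the average of the second difference
  against \<open>chi T\<close>, which has modulus 1; so some configuration reaches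
  \<open>4 * \<bar>fhat n m J h g T\<bar>\<close> in modulus.\<close>

lemma large_second_difference:
  assumes "T \<subseteq> {0..<n}" "u \<in> T" "i \<in> T" "u \<noteq> i" "fhat n m J h g T \<noteq> 0"
  obtains x where "x \<in> cube {0..<n}"
    "4 * rbm_alpha n m J h g \<le>
      \<bar>(rbm_f n m J h g (x(i := 1, u := 1)) - rbm_f n m J h g (x(i := 1, u := -1)))
        - (rbm_f n m J h g (x(i := -1, u := 1)) - rbm_f n m J h g (x(i := -1, u := -1)))\<bar>"
proof -
  let ?C = "cube {0..<n}"
  define W where "W x = rbm_f n m J h g x - rbm_f n m J h g (x(u := - x u)) - rbm_f n m J h g (x(i := - x i))
      + rbm_f n m J h g (x(u := - x u, i := - x i))" for x
  have "\<exists>x\<in>?C. 4 * rbm_alpha n m J h g \<le> \<bar>W x\<bar>"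
  proof (rule ccontr)
    assume "\<not> ?thesis"
    then have "(\<Sum>x\<in>?C. \<bar>W x\<bar>) < (\<Sum>x\<in>?C. 4 * rbm_alpha n m J h g)"
      by (intro sum_strict_mono) (auto simp: cube_nonempty not_le)
    then have less: "(\<Sum>x\<in>?C. \<bar>W x\<bar>) < 2 ^ n * (4 * rbm_alpha n m J h g)"
      by (simp add: card_cube)
    have "2 ^ n * (4 * rbm_alpha n m J h g) \<le> 4 * 2 ^ n * \<bar>fhat n m J h g T\<bar>"
      using rbm_alpha_le[OF assms(1,5)] by simp
    also have "\<dots> = \<bar>4 * 2 ^ n * fhat n m J h g T\<bar>"
      by (simp add: abs_mult)
    also have "\<dots> \<le> (\<Sum>x\<in>?C. \<bar>chi T x * W x\<bar>)"
      unfolding fhat_second_difference[OF assms(1-4)] W_def[symmetric] by (rule sum_abs)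
    also have "\<dots> = (\<Sum>x\<in>?C. \<bar>W x\<bar>)"
      using assms(1) by (intro sum.cong) (auto simp: abs_mult abs_chi)
    finally show False using less by simp
  qed
  then obtain x where x: "x \<in> ?C" "4 * rbm_alpha n m J h g \<le> \<bar>W x\<bar>" by blast
  have "x u = 1 \<or> x u = -1" "x i = 1 \<or> x i = -1"
    using cube_values[OF x(1) subsetD[OF assms(1,2)]] cube_values[OF x(1) subsetD[OF assms(1,3)]] by auto
  from second_difference_eq[OF assms(4) this, of "rbm_f n m J h g"] x that show ?thesis
    unfolding W_def by auto
qed

text \<open>Two configurations that differ only at a neighbor \<open>i\<close> outside
  \<open>S\<close> give \<open>u\<close> the same conditional probability given \<open>S\<close>,
  but clearly different ones given the neighborhood. The former cannot be close to both of the
  latter.\<close>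

lemma dep_sum_full_nbhd_ge:
  assumes u: "u < n" and S: "S \<subseteq> {0..<n} - {u}" and "\<not> mrf_nbhd n m J h g u \<subseteq> S"
  defines "N \<equiv> mrf_nbhd n m J h g u" and "E \<equiv> exp (- 2 * rbm_gamma n m J h g)"
  obtains x where "x \<in> cube {0..<n}" "x u = 1"
    "rbm_alpha n m J h g * E ^ 2 * (E / 2) ^ card N / 2
      \<le> (\<Sum>\<tau>\<in>cube S. \<bar>rbm_dep n m J h g u (N - S) S (glue S \<tau> x)\<bar>)"
proof -
  let ?f = "rbm_f n m J h g" and ?P = "rbm_prob n m J h g" and ?\<gamma> = "rbm_gamma n m J h g"
    and ?\<alpha> = "rbm_alpha n m J h g"
  obtain i T where i: "i \<in> N" "i \<notin> S" "i \<noteq> u" "i < n" and T: "T \<subseteq> {0..<n}" "u \<in> T" "i \<in> T" "fhat n m J h g T \<noteq> 0"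
    using assms(3) unfolding N_def mrf_nbhd_def by auto
  obtain x where x: "x \<in> cube {0..<n}" and "4 * ?\<alpha> \<le>
      \<bar>(?f (x(i := 1, u := 1)) - ?f (x(i := 1, u := -1))) - (?f (x(i := -1, u := 1)) - ?f (x(i := -1, u := -1)))\<bar>"
    using large_second_difference[OF T(1-3) i(3)[symmetric] T(4)] .
  define X where "X r = x(i := r, u := 1)" for r
  define \<Delta> where "\<Delta> r = ?f ((X r)(u := 1)) - ?f ((X r)(u := -1))" for r
  define s where "s r = exp (\<Delta> r) / (1 + exp (\<Delta> r))" for r
  have gap: "4 * ?\<alpha> \<le> \<bar>\<Delta> 1 - \<Delta> (-1)\<bar>"
    using \<open>4 * ?\<alpha> \<le> _\<close> by (simp add: \<Delta>_def X_def)
  have X: "X r \<in> cube {0..<n}" if "r = 1 \<or> r = -1" for r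
    unfolding X_def using that x i u by (intro cube_upd) auto
  have \<Delta>_le: "\<bar>\<Delta> r\<bar> \<le> 2 * ?\<gamma>" if "r = 1 \<or> r = -1" for r
    unfolding \<Delta>_def by (rule rbm_f_diff_le_gamma[OF X[OF that] u])
  \<comment> \<open>The log odds are at most \<open>2 * ?\<gamma>\<close> in modulus, so
    \<open>logistic_diff_ge\<close> gives slope \<open>E / 4\<close>, and the 4 cancels against the
    gap \<open>4 * ?\<alpha>\<close>.\<close>
  have "E * ?\<alpha> \<le> E / 4 * \<bar>\<Delta> 1 - \<Delta> (-1)\<bar>"
    using gap by (simp add: E_def)
  also have "\<dots> \<le> \<bar>s 1 - s (-1)\<bar>"
    unfolding s_def E_def using logistic_diff_ge[OF \<Delta>_le \<Delta>_le, of 1 "-1"] by simp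
  finally have s_gap: "E * ?\<alpha> \<le> \<bar>s 1 - s (-1)\<bar>" .
  have uN: "u \<notin> N" and Nn: "N \<subseteq> {0..<n}"
    by (auto simp: N_def mrf_nbhd_def)
  \<comment> \<open>For exactly these \<open>\<tau>\<close>, gluing leaves the spins of
    \<open>N\<close> as in \<open>X r\<close>; one set serves both values of \<open>r\<close>
    because \<open>i\<close> is not in \<open>S\<close>.\<close>
  define C where "C = {\<tau>\<in>cube S. \<forall>i\<in>S \<inter> N. \<tau> i = X 1 i}"
  define Q where "Q r \<tau> = ?P (S \<union> (N - S)) (glue S \<tau> (X r))" for r \<tau>
  define c where "c \<tau> = ?P (insert u S) (glue S \<tau> (X 1)) / ?P S (glue S \<tau> (X 1))" for \<tau>
  have Q0: "0 \<le> Q r \<tau>" for r \<tau>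
    unfolding Q_def rbm_prob_def by (intro sum_nonneg less_imp_le rbm_P_pos)
  have dep: "rbm_dep n m J h g u (N - S) S (glue S \<tau> (X r)) = Q r \<tau> * (s r - c \<tau>)"
    if \<tau>: "\<tau> \<in> C" and r: "r = 1 \<or> r = -1" for \<tau> r
  proof -
    have glue_u: "glue S \<tau> (X r) u = 1"
      using S by (auto simp: glue_def X_def)
    \<comment> \<open>All of \<open>N\<close> is fixed here, so the odds of \<open>u\<close> are
      \<open>exp (\<Delta> r)\<close> throughout the cylinder.\<close>
    have "?P (insert u (S \<union> (N - S))) (glue S \<tau> (X r)) = spin_weight (exp (\<Delta> r)) (glue S \<tau> (X r) u) * Q r \<tau>"
      unfolding Q_def rbm_prob_eq_cyl_sum
    proof (rule cyl_sum_insert)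
      show "u < n" by fact
      show "u \<notin> S \<union> (N - S)" using S uN by auto
      fix z assume z: "z \<in> cylinder n (S \<union> (N - S)) (glue S \<tau> (X r))"
      have "z l = X r l" if "l \<in> N" for l
        using that z \<tau> i by (auto simp: cylinder_def C_def glue_def X_def split: if_splits)
      then have "?f (z(u := 1)) - ?f (z(u := -1)) = \<Delta> r"
        unfolding \<Delta>_def using z X[OF r] u by (intro rbm_f_diff_cong) (auto simp: N_def cylinder_def)
      then show "rbm_P n m J h g (z(u := 1)) = exp (\<Delta> r) * rbm_P n m J h g (z(u := -1))"
        using rbm_P_upd_ratio[of n m J h g z u] by simp
    qed (auto simp: glue_u)
    \<comment> \<open>\<open>X r\<close> and \<open>X 1\<close> differ at most at \<open>i\<close>,
      which lies outside \<open>insert u S\<close>; hence \<open>c \<tau>\<close> does not depend on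
      \<open>r\<close>.\<close>
    moreover have "?P (insert u S) (glue S \<tau> (X r)) = ?P (insert u S) (glue S \<tau> (X 1))"
      "?P S (glue S \<tau> (X r)) = ?P S (glue S \<tau> (X 1))"
      by (auto simp: glue_def X_def intro!: rbm_prob_cong)
    ultimately show ?thesis
      unfolding rbm_dep_def c_def
      by (simp add: glue_u Q_def s_def spin_weight_def right_diff_distrib mult.commute)
  qed
  have Q_ratio: "E * Q 1 \<tau> \<le> Q (-1) \<tau>" for \<tau>
  proof -
    let ?A = "S \<union> (N - S) - {i}"
    have ins: "insert i ?A = S \<union> (N - S)" using i by auto
    have glue: "(glue S \<tau> (X 1))(i := 1) = glue S \<tau> (X 1)" "(glue S \<tau> (X 1))(i := -1) = glue S \<tau> (X (-1))"
      using i by (auto simp: glue_def X_def fun_eq_iff)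
    have "Q 1 \<tau> \<le> exp (2 * ?\<gamma>) * Q (-1) \<tau>"
      using rbm_prob_flip_le[of i n ?A 1 m J h g "glue S \<tau> (X 1)"] i unfolding ins glue Q_def by simp
    then have "E * Q 1 \<tau> \<le> E * (exp (2 * ?\<gamma>) * Q (-1) \<tau>)"
      by (intro mult_left_mono) (auto simp: E_def)
    also have "\<dots> = Q (-1) \<tau>"
      by (simp add: E_def exp_minus)
    finally show ?thesis .
  qed
  have E1: "0 < E" "E \<le> 1"
    using rbm_gamma_nonneg[OF u, of m J h g] by (auto simp: E_def)
  let ?D = "\<lambda>r \<tau>. \<bar>rbm_dep n m J h g u (N - S) S (glue S \<tau> (X r))\<bar>"
  have pair: "?\<alpha> * E ^ 2 * Q 1 \<tau> \<le> ?D 1 \<tau> + ?D (-1) \<tau>" if "\<tau> \<in> C" for \<tau>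
  proof -
    \<comment> \<open>One factor \<open>E\<close> comes from the logistic gap, the other from
      comparing \<open>Q 1\<close> with \<open>Q (-1)\<close>.\<close>
    have "?\<alpha> * E ^ 2 * Q 1 \<tau> = E * Q 1 \<tau> * (E * ?\<alpha>)"
      by (simp add: power2_eq_square)
    also have "\<dots> \<le> E * Q 1 \<tau> * (\<bar>s 1 - c \<tau>\<bar> + \<bar>s (-1) - c \<tau>\<bar>)"
      using s_gap E1 Q0[of 1 \<tau>] by (intro mult_left_mono) auto
    also have "\<dots> = E * Q 1 \<tau> * \<bar>s 1 - c \<tau>\<bar> + E * Q 1 \<tau> * \<bar>s (-1) - c \<tau>\<bar>"
      by (rule distrib_left)
    also have "\<dots> \<le> Q 1 \<tau> * \<bar>s 1 - c \<tau>\<bar> + Q (-1) \<tau> * \<bar>s (-1) - c \<tau>\<bar>"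
      using E1 Q0[of 1 \<tau>] Q_ratio[of \<tau>] by (intro add_mono mult_right_mono) (auto simp: mult_left_le_one_le)
    also have "\<dots> = ?D 1 \<tau> + ?D (-1) \<tau>"
      using dep[OF that] Q0 by (simp add: abs_mult)
    finally show ?thesis .
  qed
  have finS: "finite S" using finite_subset[OF S] by simp
  have X1: "X 1 l = 1 \<or> X 1 l = -1" if "l \<in> N" for l
    using cube_values[OF X subsetD[OF Nn that]] by simp
  have "?\<alpha> * E ^ 2 * (E / 2) ^ card N \<le> ?\<alpha> * E ^ 2 * ?P N (X 1)"
    unfolding E_def using rbm_alpha_pos[OF T(1,4)] X1 Nn
    by (intro mult_left_mono rbm_prob_ge) auto
  \<comment> \<open>Summing out the part of \<open>S\<close> outside \<open>N\<close> leaves the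
    probability of the neighborhood alone, so the lower bound has exponent \<open>card N\<close>
    whatever the size of \<open>S\<close>.\<close>
  also have "?P N (X 1) = (\<Sum>\<tau>\<in>C. Q 1 \<tau>)"
  proof -
    have "(\<Sum>\<tau>\<in>C. Q 1 \<tau>) = (\<Sum>\<tau>\<in>C. ?P (N \<union> S) (\<lambda>i. if i \<in> S then \<tau> i else X 1 i))"
      unfolding Q_def by (intro sum.cong refl) (simp add: Un_commute glue_def[abs_def])
    also have "\<dots> = ?P N (X 1)"
      unfolding C_def rbm_prob_eq_cyl_sum using S by (intro cyl_sum_marginal) auto
    finally show ?thesis by simp
  qed
  also have "?\<alpha> * E ^ 2 * (\<Sum>\<tau>\<in>C. Q 1 \<tau>) \<le> (\<Sum>\<tau>\<in>C. ?D 1 \<tau> + ?D (-1) \<tau>)"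
    unfolding sum_distrib_left by (intro sum_mono pair)
  also have "\<dots> \<le> (\<Sum>\<tau>\<in>cube S. ?D 1 \<tau> + ?D (-1) \<tau>)"
    using finS by (intro sum_mono2) (auto simp: C_def)
  also have "\<dots> = (\<Sum>\<tau>\<in>cube S. ?D 1 \<tau>) + (\<Sum>\<tau>\<in>cube S. ?D (-1) \<tau>)"
    by (rule sum.distrib)
  \<comment> \<open>At least one of the two configurations carries half of the total.\<close>
  finally have "?\<alpha> * E ^ 2 * (E / 2) ^ card N / 2 \<le> (\<Sum>\<tau>\<in>cube S. ?D 1 \<tau>)
      \<or> ?\<alpha> * E ^ 2 * (E / 2) ^ card N / 2 \<le> (\<Sum>\<tau>\<in>cube S. ?D (-1) \<tau>)"
    by linarith
  moreover have "X r u = 1" for r by (simp add: X_def)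
  ultimately show ?thesis
    using that[OF X] by blast
qed

section \<open>Passage to a small subset and comparison of constants\<close>

text \<open>The conclusion includes \<open>I \<inter> S = {}\<close> because the dependence measure
  is meant for disjoint sets.\<close>

theorem theorem3:
  fixes n m :: nat and J :: "nat \<Rightarrow> nat \<Rightarrow> real" and h g :: "nat \<Rightarrow> real"
    and u :: nat and S :: "nat set"
  assumes "u < n"
    and "S \<subseteq> {0..<n} - {u}"
    and "\<not> mrf_nbhd n m J h g u \<subseteq> S"
  shows "\<exists>I. I \<subseteq> mrf_nbhd n m J h g u \<and> I \<inter> S = {} \<and>
           card I \<le> 2 ^ rbm_s n m J h g \<and>
           nu n m J h g u I S \<ge>
             (let d = rbm_d n m J; s = rbm_s n m J h g; D = rbm_D n m J h g;
                  \<alpha> = rbm_alpha n m J h g; \<gamma> = rbm_gamma n m J h g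
              in 1 / (4 * real d) ^ (2 ^ s) * (1 / real d) ^ (2 ^ s * (2 ^ s + 1)) *
                 (4 * \<alpha>\<^sup>2 * exp (- 2 * \<gamma>) ^ (d + D - 1)) /
                 (real d ^ (4 * d) * 2 ^ (d + 1) * real (D choose (d - 1)) * \<gamma> * exp (2 * \<gamma>)))"
proof -
  define d s D where "d = rbm_d n m J" "s = rbm_s n m J h g" "D = rbm_D n m J h g"
  define \<alpha> \<gamma> where "\<alpha> = rbm_alpha n m J h g" "\<gamma> = rbm_gamma n m J h g"
  define N H where "N = mrf_nbhd n m J h g u" "H = nbhd_latents n m J h g u"
  define E where "E = exp (- 2 * \<gamma>)"
  define k :: nat where "k = 2 ^ s"
  note defs = d_s_D_def \<alpha>_\<gamma>_def N_H_def
  obtain i T where i: "i \<in> N" "i \<notin> S" and T: "T \<subseteq> {0..<n}" "u \<in> T" "fhat n m J h g T \<noteq> 0"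
    using assms(3) unfolding defs mrf_nbhd_def by auto
  have d2: "2 \<le> d" and s1: "1 \<le> s"
    using rbm_d_ge_2 rbm_s_ge_1 i assms(1) unfolding defs by blast+
  have DD: "D \<le> s * d" unfolding defs by (rule rbm_D_le)
  have \<alpha>: "0 < \<alpha>" "\<alpha> \<le> \<gamma>"
    using rbm_alpha_pos[OF T(1,3)] rbm_alpha_le_gamma[OF T] by (auto simp: defs)
  have E: "0 < E" "E \<le> 1" using \<alpha> by (auto simp: E_def)
  have N: "N \<subseteq> {0..<n} - {u}" "card N \<le> D" "finite N"
    using card_mrf_nbhd_le[OF assms(1)] by (auto simp: defs mrf_nbhd_def)
  have H: "H \<subseteq> {..<m}" "card H \<le> s"
    using card_nbhd_latents_le[OF assms(1)] by (auto simp: defs nbhd_latents_def)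
  obtain x where x: "x \<in> cube {0..<n}" "x u = 1" and
    low: "\<alpha> * E ^ 2 * (E / 2) ^ card N / 2 \<le> (\<Sum>\<tau>\<in>cube S. \<bar>rbm_dep n m J h g u (N - S) S (glue S \<tau> x)\<bar>)"
    using dep_sum_full_nbhd_ge[OF assms] unfolding defs E_def by blast
  obtain I where I: "I \<subseteq> N - S" "card I \<le> 2 ^ card H - 1" and
    up: "(\<Sum>\<tau>\<in>cube S. \<bar>rbm_dep n m J h g u (N - S) S (glue S \<tau> x)\<bar>)
      \<le> (2 * real (card (N - S)) + 1) ^ (2 ^ card H - 1) * (\<Sum>\<tau>\<in>cube S. \<bar>rbm_dep n m J h g u I S (glue S \<tau> x)\<bar>)"
      (is "_ \<le> ?c * ?V")
  proof (rule rbm_dep_subset[of "N - S" n u S H m x J h g])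
    show "x l = 1 \<or> x l = -1" if "l \<in> N - S" for l
      using that N(1) by (intro cube_values[OF x(1)]) auto
    show "J l j = 0" if "l \<in> N - S" "j < m" "j \<notin> H" for l j
      using that by (auto simp: defs nbhd_latents_def)
  qed (use assms N H in auto)
  have kk: "2 ^ card H - 1 \<le> k - 1"
    unfolding k_def using H by (intro diff_le_mono power_increasing) auto
  have Ik: "card I \<le> k - 1" using I kk by simp
  have V0: "0 \<le> ?V" by (intro sum_nonneg) auto
  have c: "?c \<le> (2 * real D + 1) ^ (k - 1)"
  proof -
    have "card (N - S) \<le> D"
      using N card_mono[of N "N - S"] by auto
    then have "?c \<le> (2 * real D + 1) ^ (2 ^ card H - 1)"
      by (intro power_mono) auto
    also have "\<dots> \<le> (2 * real D + 1) ^ (k - 1)"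
      using kk by (intro power_increasing) auto
    finally show ?thesis .
  qed
  \<comment> \<open>\<open>X\<close> collects the losses: \<open>2 ^ (D + 1)\<close> from the bound
    for the whole neighborhood, \<open>(2 * real D + 1) ^ (k - 1)\<close> from the passage to
    \<open>I\<close>, and \<open>2 ^ k\<close> from the uniform R and G. The 4 in
    \<open>4 * X \<le> Y\<close> is the one in the claimed numerator.\<close>
  define X where "X = 2 ^ (D + 2) * (2 * (2 * real D + 1)) ^ (k - 1)"
  define Y where "Y = (4 * real d) ^ k * real d ^ (k * (k + 1)) * real d ^ (4 * d) * 2 ^ (d + 1)"
  have X0: "0 < X" and Y0: "0 < Y" using d2 by (auto simp: X_def Y_def)
  have "real (2 ^ (D + 2) * (2 * (2 * D + 1)) ^ (k - 1) * 4)
      \<le> real ((4 * d) ^ k * d ^ (k * (k + 1)) * d ^ (4 * d) * 2 ^ (d + 1))"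
    unfolding k_def of_nat_le_iff by (rule mixture_constants_bound[OF d2 s1 DD])
  then have XY: "4 * X \<le> Y"
    unfolding X_def Y_def by (simp add: algebra_simps)
  have nu_ge: "\<alpha> * E ^ (D + 2) / X \<le> nu n m J h g u I S"
  proof -
    have "\<alpha> * E ^ (D + 2) / 2 ^ (D + 1) = \<alpha> * E ^ 2 * (E / 2) ^ D / 2"
      by (simp add: power_add power_divide power2_eq_square mult_ac)
    also have "\<dots> \<le> \<alpha> * E ^ 2 * (E / 2) ^ card N / 2"
      using N E \<alpha> by (intro divide_right_mono mult_left_mono power_decreasing) auto
    also have "\<dots> \<le> ?c * ?V"
      using low up by simp
    also have "\<dots> \<le> (2 * real D + 1) ^ (k - 1) * ?V"
      using c V0 by (rule mult_right_mono)
    finally have "\<alpha> * E ^ (D + 2) / 2 ^ (D + 1) \<le> (2 * real D + 1) ^ (k - 1) * ?V" .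
    then have "\<alpha> * E ^ (D + 2) / 2 ^ (D + 1) / (2 * real D + 1) ^ (k - 1) \<le> ?V"
      by (simp add: divide_le_eq mult_ac)
    then have "\<alpha> * E ^ (D + 2) / 2 ^ (D + 1) / (2 * real D + 1) ^ (k - 1) / 2 ^ k \<le> ?V / 2 ^ k"
      by (intro divide_right_mono) auto
    moreover have "\<alpha> * E ^ (D + 2) / 2 ^ (D + 1) / (2 * real D + 1) ^ (k - 1) / 2 ^ k = \<alpha> * E ^ (D + 2) / X"
    proof -
      have "2 ^ k = 2 * (2::real) ^ (k - 1)"
        by (simp add: k_def flip: power_Suc)
      then have "X = 2 ^ (D + 1) * (2 * real D + 1) ^ (k - 1) * 2 ^ k"
        unfolding X_def power_mult_distrib by simp
      then show ?thesis by simp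
    qed
    moreover have "?V / 2 ^ k \<le> ?V / 2 ^ (card I + 1)"
    proof -
      \<comment> \<open>The bound \<open>k - 1\<close> for \<open>card I\<close> leaves room for the
        additional factor 1/2 of the uniform spin R.\<close>
      have "card I + 1 \<le> k" using Ik by (simp add: k_def le_diff_conv2)
      then show ?thesis
        using V0 by (intro divide_left_mono power_increasing) auto
    qed
    moreover have "?V / 2 ^ (card I + 1) \<le> nu n m J h g u I S"
      using assms N I x by (intro nu_ge_dep_sum cube_values[OF x(1)]) auto
    ultimately show ?thesis by linarith
  qed
  have bound: "1 / (4 * real d) ^ (2 ^ s) * (1 / real d) ^ (2 ^ s * (2 ^ s + 1)) *
                 (4 * \<alpha>\<^sup>2 * exp (- 2 * \<gamma>) ^ (d + D - 1)) /
                 (real d ^ (4 * d) * 2 ^ (d + 1) * real (D choose (d - 1)) * \<gamma> * exp (2 * \<gamma>))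
      \<le> \<alpha> * E ^ (D + 2) / X" (is "?rhs \<le> _")
    \<comment> \<open>If the binomial coefficient vanishes, so does the bound, since x / 0 = 0.\<close>
  proof (cases "D choose (d - 1) = 0")
    case True
    show ?thesis
      unfolding True using \<alpha> E X0 by simp
  next
    case False
    define b where "b = real (D choose (d - 1))"
    have B: "1 \<le> b" using False unfolding b_def by linarith
    \<comment> \<open>Dividing by \<open>exp (2 * \<gamma>)\<close> supplies one more
      \<open>E\<close>; the subtraction of naturals is exact since \<open>d\<close> is
      positive.\<close>
    have "E ^ (d + D - 1) / exp (2 * \<gamma>) = E ^ (d + D)"
      using d2 by (cases d) (auto simp: E_def exp_minus field_simps)
    then have "?rhs = (4 * \<alpha> / Y) * (\<alpha> / \<gamma>) * E ^ (d + D) / b"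
      unfolding b_def[symmetric] Y_def E_def[symmetric] k_def[symmetric]
      by (simp add: power_one_over power2_eq_square divide_simps)
    also have "\<dots> \<le> (4 * \<alpha> / Y) * (\<alpha> / \<gamma>) * E ^ (d + D) / 1"
      using B \<alpha> E Y0 by (intro divide_left_mono) auto
    \<comment> \<open>Here \<open>\<alpha> \<le> \<gamma>\<close> removes the quotient, and
      \<open>2 \<le> d\<close> with \<open>E \<le> 1\<close> lowers the exponent to
      \<open>D + 2\<close>.\<close>
    also have "\<dots> \<le> (4 * \<alpha> / Y) * 1 * E ^ (D + 2) / 1"
      using \<alpha> E Y0 d2 by (intro divide_right_mono mult_mono power_decreasing) auto
    also have "\<dots> = \<alpha> * E ^ (D + 2) * (4 / Y)" by simp
    also have "\<dots> \<le> \<alpha> * E ^ (D + 2) * (1 / X)"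
      using XY X0 Y0 \<alpha> E by (intro mult_left_mono) (auto simp: field_simps)
    finally show ?thesis by simp
  qed
  have "card I \<le> 2 ^ s" using Ik by (simp add: k_def)
  moreover have "I \<subseteq> N" "I \<inter> S = {}" using I by auto
  moreover have "?rhs \<le> nu n m J h g u I S" using bound nu_ge by linarith
  ultimately show ?thesis
    unfolding Let_def defs by blast
qed

end
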